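(* Let $\omega=(q_n)_{n=1}^{\infty}$ be a sequence of real numbers in $(0,1)$ having lower and upper bounds, i.e. there exists $\delta>0$ such that $\delta\le q_n\le 1-\delta$ for all $n\in\mathbb N$. Let $E(\omega)$ be the random Cantor set for $\omega$. Then $X_{E(\omega)}=\widehat{\mathbb C}\setminus E(\omega)$ is quasiconformally equivalent to $X_{\mathcal C}=\widehat{\mathbb C}\setminus\mathcal C$, where $\mathcal C\subset[0,1]$ is the standard middle one-third Cantor set.
   Context: Random Cantor set $E(\omega)$: for a sequence $\omega=(q_n)_{n\ge1}$ with $0<q_n<1$, put $E_0=[0,1]$. Inductively, $E_k$ is a disjoint union of $2^k$ closed intervals of equal length, and $E_{k+1}$ is obtained from $E_k$ by removing from each of these closed intervals $I$ the concentric open interval of length $q_{k+1}|I|$, where $|I|$ is the length of $I$. Then $E(\omega)=\bigcap_{k\ge1}E_k$. (Despite the name, the construction is deterministic.) Two Riemann surfaces are quasiconformally equivalent if there exists a quasiconformal homeomorphism of one onto the other. *)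

theory Defs
  imports "HOL-Analysis.Analysis"
begin

section \<open>The Cantor set of a sequence of removal ratios\<close>

text \<open>An interval is encoded by its pair of endpoints. Removing from \<open>{a..b}\<close> the concentric open
  interval of length \<open>r * (b - a)\<close> leaves the two intervals below (see \<open>cantor_split_removal\<close>).\<close>

definition cantor_split :: "real \<Rightarrow> real \<times> real \<Rightarrow> (real \<times> real) set" where
  "cantor_split r I = (case I of (a, b) \<Rightarrow>
     {(a, (a + b) / 2 - r * (b - a) / 2), ((a + b) / 2 + r * (b - a) / 2, b)})"

lemma cantor_split_removal:
  assumes "0 < r" "r < 1" "a \<le> b"
  shows "(\<Union>(s, t)\<in>cantor_split r (a, b). {s..t}) =
    {a..b} - {(a + b) / 2 - r * (b - a) / 2 <..< (a + b) / 2 + r * (b - a) / 2}"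
proof -
  have "r * (b - a) \<le> b - a"
    using mult_right_mono[of r 1 "b - a"] assms by simp
  moreover have "0 \<le> r * (b - a)"
    using assms by simp
  ultimately show ?thesis
    by (auto simp: cantor_split_def field_simps)
qed

text \<open>Sequences \<open>q\<close> are indexed from 1: the step from stage \<open>k\<close> to stage \<open>k + 1\<close> uses
  \<open>q (k + 1)\<close>, and \<open>q 0\<close> is never used.\<close>

fun cantor_intervals :: "(nat \<Rightarrow> real) \<Rightarrow> nat \<Rightarrow> (real \<times> real) set" where
  "cantor_intervals q 0 = {(0, 1)}"
| "cantor_intervals q (Suc k) = (\<Union>I\<in>cantor_intervals q k. cantor_split (q (Suc k)) I)"

definition cantor_stage :: "(nat \<Rightarrow> real) \<Rightarrow> nat \<Rightarrow> real set" where
  "cantor_stage q k = (\<Union>(a, b)\<in>cantor_intervals q k. {a..b})"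

definition random_cantor_set :: "(nat \<Rightarrow> real) \<Rightarrow> real set" where
  "random_cantor_set q = (\<Inter>k\<in>{1..}. cantor_stage q k)"

definition middle_third_cantor_set :: "real set" where
  "middle_third_cantor_set = random_cantor_set (\<lambda>n. 1 / 3)"


section \<open>Quasiconformal maps between open subsets of the plane\<close>

definition abs_continuous_on_interval :: "real \<Rightarrow> real \<Rightarrow> (real \<Rightarrow> complex) \<Rightarrow> bool" where
  "abs_continuous_on_interval a b g \<longleftrightarrow>
     (\<forall>\<epsilon>>0. \<exists>\<delta>>0. \<forall>D::(real \<times> real) set.
        finite D \<and> (\<forall>(s, t)\<in>D. a \<le> s \<and> s \<le> t \<and> t \<le> b) \<and>
        disjoint_family_on (\<lambda>(s, t). {s<..<t}) D \<and> (\<Sum>(s, t)\<in>D. t - s) < \<delta>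
        \<longrightarrow> (\<Sum>(s, t)\<in>D. cmod (g t - g s)) < \<epsilon>)"

text \<open>Absolute continuity on lines: in every closed rectangle contained in \<open>U\<close> with sides parallel
  to the axes, \<open>f\<close> is absolutely continuous on almost every horizontal and almost every vertical
  segment.\<close>

definition ACL_on :: "complex set \<Rightarrow> (complex \<Rightarrow> complex) \<Rightarrow> bool" where
  "ACL_on U f \<longleftrightarrow> (\<forall>a b c d. cbox (Complex a c) (Complex b d) \<subseteq> U \<longrightarrow>
     (AE y in lborel. y \<in> {c..d} \<longrightarrow> abs_continuous_on_interval a b (\<lambda>x. f (Complex x y))) \<and>
     (AE x in lborel. x \<in> {a..b} \<longrightarrow> abs_continuous_on_interval c d (\<lambda>y. f (Complex x y))))"

text \<open>The analytic definition of a \<open>K\<close>-quasiconformal map: a homeomorphism that is ACL and satisfies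
  \<open>\<bar>f\<^bsub>zbar\<^esub>\<bar> \<le> k \<bar>f\<^bsub>z\<^esub>\<bar>\<close> almost everywhere, \<open>k = (K - 1) / (K + 1)\<close>. Below
  \<open>p\<close> and \<open>q\<close> are the partial derivatives in \<open>x\<close> and \<open>y\<close>, so that
  \<open>f\<^bsub>z\<^esub> = (p - \<i> q) / 2\<close> and \<open>f\<^bsub>zbar\<^esub> = (p + \<i> q) / 2\<close>.
  The strict inequality \<open>k < 1\<close> excludes orientation-reversing maps.\<close>

definition quasiconformal_on :: "real \<Rightarrow> complex set \<Rightarrow> (complex \<Rightarrow> complex) \<Rightarrow> bool" where
  "quasiconformal_on K U f \<longleftrightarrow>
     K \<ge> 1 \<and> open U \<and> (\<exists>g. homeomorphism U (f ` U) f g) \<and> ACL_on U f \<and>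
     (AE z in lborel. z \<in> U \<longrightarrow>
        (\<exists>p q. ((\<lambda>x. f (Complex x (Im z))) has_vector_derivative p) (at (Re z)) \<and>
               ((\<lambda>y. f (Complex (Re z) y)) has_vector_derivative q) (at (Im z)) \<and>
               cmod ((p + \<i> * q) / 2) \<le> (K - 1) / (K + 1) * cmod ((p - \<i> * q) / 2)))"


section \<open>Quasiconformal equivalence of open subsets of the Riemann sphere\<close>

text \<open>\<open>None\<close> is the point at infinity.\<close>

definition riemann_sphere :: "complex option topology" where
  "riemann_sphere = Alexandroff_compactification euclidean"

text \<open>The holomorphic atlas, as pairs of a domain and a coordinate: the identity on the plane, and
  \<open>1 / z\<close> on the complement of the origin.\<close>

definition sphere_charts :: "(complex option set \<times> (complex option \<Rightarrow> complex)) set" where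
  "sphere_charts =
     {(range Some, the),
      (- {Some 0}, \<lambda>p. case p of None \<Rightarrow> 0 | Some z \<Rightarrow> 1 / z)}"

definition quasiconformal_homeomorphism ::
    "real \<Rightarrow> complex option set \<Rightarrow> complex option set \<Rightarrow> (complex option \<Rightarrow> complex option) \<Rightarrow> bool" where
  "quasiconformal_homeomorphism K X Y f \<longleftrightarrow>
     openin riemann_sphere X \<and> openin riemann_sphere Y \<and>
     homeomorphic_map (subtopology riemann_sphere X) (subtopology riemann_sphere Y) f \<and>
     (\<forall>(D, \<phi>)\<in>sphere_charts. \<forall>(D', \<psi>)\<in>sphere_charts.
        quasiconformal_on K (\<phi> ` {p \<in> X. p \<in> D \<and> f p \<in> D'}) (\<psi> \<circ> f \<circ> inv_into D \<phi>))"

definition quasiconformally_equivalent :: "complex option set \<Rightarrow> complex option set \<Rightarrow> bool" where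
  "quasiconformally_equivalent X Y \<longleftrightarrow> (\<exists>K f. quasiconformal_homeomorphism K X Y f)"

definition sphere_complement :: "real set \<Rightarrow> complex option set" where
  "sphere_complement E = topspace riemann_sphere - (\<lambda>x. Some (complex_of_real x)) ` E"

end

(* A quasisymmetric homeomorphism h of the line with h(E(omega)) = C extends to a quasiconformal
homeomorphism of the plane by the Beurling-Ahlfors formula, and this extension maps the complement of
E(omega) onto the complement of C.

To find h, split every interval, also those inside the removed gaps, into three parts in the
proportions (1 - q_n)/2 : q_n : (1 - q_n)/2. Since the outer proportions agree, neighbouring intervals
of one generation have comparable lengths, and the map h that sends this partition of the line to the
triadic one is quasisymmetric. It maps the intervals of the n-th stage of E(omega) to those of C.

The extension is smooth off the real axis, where quasisymmetry bounds its dilatation. Across the axis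
absolute continuity comes for free: along a path crossing the axis the averages that make up the
extension are monotone up to a term with bounded derivative. *)

theory Submission
  imports Defs
begin

section \<open>Absolute continuity on intervals\<close>

text \<open>The bound on the ratios enters in two ways: neighbouring cells are comparable with
  constant \<open>2 / \<delta>\<close>, and cells shrink by a factor of at most
  \<open>1 - \<delta>\<close> per generation. A fixed number of further generations therefore
  outweighs the comparison constant, which gives quasisymmetry at small scales. Upwards there is no
  generation coarser than the integers; since \<open>h\<close> fixes the integers,
  \<open>\<bar>h x - x\<bar> \<le> 1\<close> takes over at large scales. The same inequality makes
  the extension proper, hence onto, and continuous at infinity.

  In the coordinate \<open>1 / z\<close> the coordinate lines become circles through 0, so absolute
  continuity is proved along paths that cross the real axis suitably, not only along segments.

  The point 0 belongs to both Cantor sets and is fixed by \<open>h\<close>. Hence the extension has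
  no zero on the complement, and its reciprocal has no pole there.\<close>

lemma sum_increments_le:
  fixes m :: "real \<Rightarrow> real"
  assumes "mono m" "finite D" "\<forall>(s, t)\<in>D. a \<le> s \<and> s \<le> t \<and> t \<le> b"
    "disjoint_family_on (\<lambda>(s, t). {s<..<t}) D" "a \<le> b"
  shows "(\<Sum>(s, t)\<in>D. m t - m s) \<le> m b - m a"
proof -
  \<comment> \<open>A degenerate pair contributes 0, but its open interval is empty and its point
    may lie inside another interval, which would spoil the ordering used below.\<close>
  define D' where "D' = {p \<in> D. fst p < snd p}"
  have "finite D'" "\<forall>p\<in>D'. a \<le> fst p \<and> fst p < snd p \<and> snd p \<le> b"
    "\<forall>p\<in>D'. \<forall>p'\<in>D'. p \<noteq> p' \<longrightarrow> {fst p<..<snd p} \<inter> {fst p'<..<snd p'} = {}"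
    using assms by (fastforce simp: D'_def disjoint_family_on_def split_beta)+
  then have "(\<Sum>p\<in>D'. m (snd p) - m (fst p)) \<le> m b - m a"
    using \<open>a \<le> b\<close>
  \<comment> \<open>The interval with the largest right endpoint is split off. All others end before
    it starts, so the induction hypothesis applies with its left endpoint in place of
    \<open>b\<close>.\<close>
  proof (induction D' arbitrary: b rule: finite_ranking_induct[where f = snd])
    case empty
    then show ?case using \<open>mono m\<close> by (simp add: monoD)
  next
    case (insert p S)
    show ?case
    proof (cases "p \<in> S")
      case True
      then show ?thesis using insert by (simp add: insert_absorb)
    next
      case False
      have "snd p' \<le> fst p" if p': "p' \<in> S" for p'
      proof (rule ccontr)
        assume "\<not> snd p' \<le> fst p"
        then obtain x where x: "max (fst p) (fst p') < x" "x < snd p'"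
          using insert.prems(1) p' dense[of "max (fst p) (fst p')" "snd p'"] by auto
        have "snd p' \<le> snd p" "p \<noteq> p'"
          using insert that False by auto
        then have "x \<in> {fst p<..<snd p} \<inter> {fst p'<..<snd p'}"
          using x by auto
        then show False
          using insert.prems(2) that \<open>p \<noteq> p'\<close> by blast
      qed
      then have "(\<Sum>p\<in>S. m (snd p) - m (fst p)) \<le> m (fst p) - m a"
        using insert.prems by (intro insert.IH) auto
      moreover have "m (snd p) \<le> m b"
        using insert.prems \<open>mono m\<close> by (simp add: monoD)
      ultimately show ?thesis
        using insert False by simp
    qed
  qed
  moreover have "(\<Sum>p\<in>D. m (snd p) - m (fst p)) = (\<Sum>p\<in>D'. m (snd p) - m (fst p))"
    using assms(2,3) by (intro sum.mono_neutral_right) (force simp: D'_def)+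
  ultimately show ?thesis
    by (simp add: split_beta)
qed

lemma abs_continuous_add:
  assumes "abs_continuous_on_interval a b f" "abs_continuous_on_interval a b g"
  shows "abs_continuous_on_interval a b (\<lambda>x. f x + g x)"
  unfolding abs_continuous_on_interval_def
proof (intro allI impI)
  fix \<epsilon> :: real assume "\<epsilon> > 0"
  then have "\<epsilon> / 2 > 0" by simp
  obtain d1 where d1: "d1 > 0" "\<And>D. finite D \<and> (\<forall>(s, t)\<in>D. a \<le> s \<and> s \<le> t \<and> t \<le> b) \<and>
        disjoint_family_on (\<lambda>(s, t). {s<..<t}) D \<and> (\<Sum>(s, t)\<in>D. t - s) < d1
        \<Longrightarrow> (\<Sum>(s, t)\<in>D. cmod (f t - f s)) < \<epsilon> / 2"
    using assms(1) \<open>\<epsilon> / 2 > 0\<close> unfolding abs_continuous_on_interval_def by meson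
  obtain d2 where d2: "d2 > 0" "\<And>D. finite D \<and> (\<forall>(s, t)\<in>D. a \<le> s \<and> s \<le> t \<and> t \<le> b) \<and>
        disjoint_family_on (\<lambda>(s, t). {s<..<t}) D \<and> (\<Sum>(s, t)\<in>D. t - s) < d2
        \<Longrightarrow> (\<Sum>(s, t)\<in>D. cmod (g t - g s)) < \<epsilon> / 2"
    using assms(2) \<open>\<epsilon> / 2 > 0\<close> unfolding abs_continuous_on_interval_def by meson
  have "(\<Sum>(s, t)\<in>D. cmod (f t + g t - (f s + g s))) < \<epsilon>"
    if "finite D \<and> (\<forall>(s, t)\<in>D. a \<le> s \<and> s \<le> t \<and> t \<le> b) \<and>
        disjoint_family_on (\<lambda>(s, t). {s<..<t}) D \<and> (\<Sum>(s, t)\<in>D. t - s) < min d1 d2" for D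
  proof -
    have "(\<Sum>(s, t)\<in>D. cmod (f t + g t - (f s + g s)))
        \<le> (\<Sum>(s, t)\<in>D. cmod (f t - f s) + cmod (g t - g s))"
      unfolding split_beta by (intro sum_mono norm_diff_triangle_ineq)
    also have "\<dots> = (\<Sum>(s, t)\<in>D. cmod (f t - f s)) + (\<Sum>(s, t)\<in>D. cmod (g t - g s))"
      by (simp add: split_beta sum.distrib)
    also have "\<dots> < \<epsilon>"
      using d1(2)[of D] d2(2)[of D] that by simp
    finally show ?thesis .
  qed
  then show "\<exists>\<delta>>0. \<forall>D. finite D \<and> (\<forall>(s, t)\<in>D. a \<le> s \<and> s \<le> t \<and> t \<le> b) \<and>
        disjoint_family_on (\<lambda>(s, t). {s<..<t}) D \<and> (\<Sum>(s, t)\<in>D. t - s) < \<delta>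
        \<longrightarrow> (\<Sum>(s, t)\<in>D. cmod (f t + g t - (f s + g s))) < \<epsilon>"
    using d1(1) d2(1) by (intro exI[of _ "min d1 d2"]) auto
qed

lemma abs_continuous_dominated:
  assumes "abs_continuous_on_interval a b f" "L \<ge> 0"
    "\<And>s t. a \<le> s \<Longrightarrow> s \<le> t \<Longrightarrow> t \<le> b \<Longrightarrow> cmod (g t - g s) \<le> L * cmod (f t - f s)"
  shows "abs_continuous_on_interval a b g"
  unfolding abs_continuous_on_interval_def
proof (intro allI impI)
  fix \<epsilon> :: real assume "\<epsilon> > 0"
  \<comment> \<open>\<open>L + 1\<close> instead of \<open>L\<close>, because \<open>L = 0\<close>
    is allowed.\<close>
  then have "\<epsilon> / (L + 1) > 0" using \<open>L \<ge> 0\<close> by simp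
  then obtain d where d: "d > 0" "\<And>D. finite D \<and> (\<forall>(s, t)\<in>D. a \<le> s \<and> s \<le> t \<and> t \<le> b) \<and>
        disjoint_family_on (\<lambda>(s, t). {s<..<t}) D \<and> (\<Sum>(s, t)\<in>D. t - s) < d
        \<Longrightarrow> (\<Sum>(s, t)\<in>D. cmod (f t - f s)) < \<epsilon> / (L + 1)"
    using assms(1) unfolding abs_continuous_on_interval_def by meson
  have "(\<Sum>(s, t)\<in>D. cmod (g t - g s)) < \<epsilon>"
    if D: "finite D \<and> (\<forall>(s, t)\<in>D. a \<le> s \<and> s \<le> t \<and> t \<le> b) \<and>
        disjoint_family_on (\<lambda>(s, t). {s<..<t}) D \<and> (\<Sum>(s, t)\<in>D. t - s) < d" for D
  proof -
    have "(\<Sum>(s, t)\<in>D. cmod (g t - g s)) \<le> (\<Sum>(s, t)\<in>D. (L + 1) * cmod (f t - f s))"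
    proof (intro sum_mono, clarify)
      fix s t assume "(s, t) \<in> D"
      then have "cmod (g t - g s) \<le> L * cmod (f t - f s)"
        using D assms(3) by blast
      then show "cmod (g t - g s) \<le> (L + 1) * cmod (f t - f s)"
        by (simp add: distrib_right add_increasing2)
    qed
    also have "\<dots> = (L + 1) * (\<Sum>(s, t)\<in>D. cmod (f t - f s))"
      by (simp add: split_beta sum_distrib_left)
    also have "\<dots> < (L + 1) * (\<epsilon> / (L + 1))"
      using d(2)[OF D] \<open>L \<ge> 0\<close> by (intro mult_strict_left_mono) auto
    finally show ?thesis using \<open>L \<ge> 0\<close> by simp
  qed
  then show "\<exists>\<delta>>0. \<forall>D. finite D \<and> (\<forall>(s, t)\<in>D. a \<le> s \<and> s \<le> t \<and> t \<le> b) \<and>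
        disjoint_family_on (\<lambda>(s, t). {s<..<t}) D \<and> (\<Sum>(s, t)\<in>D. t - s) < \<delta>
        \<longrightarrow> (\<Sum>(s, t)\<in>D. cmod (g t - g s)) < \<epsilon>"
    using d(1) by blast
qed

lemma abs_continuous_cmult:
  assumes "abs_continuous_on_interval a b f"
  shows "abs_continuous_on_interval a b (\<lambda>x. c * f x)"
  by (rule abs_continuous_dominated[OF assms, of "cmod c"])
     (auto simp: norm_mult simp flip: right_diff_distrib)

lemma abs_continuous_of_real_id: "abs_continuous_on_interval a b of_real"
  unfolding abs_continuous_on_interval_def
proof (intro allI impI)
  fix \<epsilon> :: real assume "\<epsilon> > 0"
  have "(\<Sum>(s, t)\<in>D. cmod (complex_of_real t - complex_of_real s)) = (\<Sum>(s, t)\<in>D. t - s)"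
    if "\<forall>(s, t)\<in>D. a \<le> s \<and> s \<le> t \<and> t \<le> b" for D
    using that by (intro sum.cong) (auto simp flip: of_real_diff)
  then show "\<exists>\<delta>>0. \<forall>D. finite D \<and> (\<forall>(s, t)\<in>D. a \<le> s \<and> s \<le> t \<and> t \<le> b) \<and>
        disjoint_family_on (\<lambda>(s, t). {s<..<t}) D \<and> (\<Sum>(s, t)\<in>D. t - s) < \<delta>
        \<longrightarrow> (\<Sum>(s, t)\<in>D. cmod (complex_of_real t - complex_of_real s)) < \<epsilon>"
    using \<open>\<epsilon> > 0\<close> by (intro exI[of _ \<epsilon>]) auto
qed

lemma abs_continuous_lipschitz:
  assumes "L \<ge> 0"
    "\<And>s t. a \<le> s \<Longrightarrow> s \<le> t \<Longrightarrow> t \<le> b \<Longrightarrow> cmod (g t - g s) \<le> L * (t - s)"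
  shows "abs_continuous_on_interval a b g"
  by (rule abs_continuous_dominated[OF abs_continuous_of_real_id \<open>L \<ge> 0\<close>])
     (use assms in \<open>auto simp flip: of_real_diff\<close>)

lemma lipschitz_of_continuous_deriv:
  fixes f f' :: "real \<Rightarrow> real"
  assumes "continuous_on {a..b} f'"
    "\<And>s. a \<le> s \<Longrightarrow> s \<le> b \<Longrightarrow> (f has_real_derivative f' s) (at s)"
  obtains L where "L \<ge> 0" "\<And>s t. a \<le> s \<Longrightarrow> s \<le> t \<Longrightarrow> t \<le> b \<Longrightarrow> \<bar>f t - f s\<bar> \<le> L * (t - s)"
proof -
  have "bounded (f' ` {a..b})"
    using assms(1) by (simp add: compact_continuous_image compact_imp_bounded)
  then obtain L where L: "\<And>s. s \<in> {a..b} \<Longrightarrow> \<bar>f' s\<bar> \<le> L"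
    unfolding bounded_iff real_norm_def by blast
  have "\<bar>f t - f s\<bar> \<le> max 0 L * (t - s)" if st: "a \<le> s" "s \<le> t" "t \<le> b" for s t
  proof (cases "s = t")
    case False
    then obtain z where z: "z > s" "z < t" "f t - f s = (t - s) * f' z"
      using MVT2[of s t f f'] assms(2) st by auto
    have "\<bar>f t - f s\<bar> = (t - s) * \<bar>f' z\<bar>"
      using st by (simp add: z abs_mult)
    also have "\<dots> \<le> (t - s) * max 0 L"
      using L[of z] z st by (intro mult_left_mono) auto
    finally show ?thesis by (simp add: mult.commute)
  qed simp
  then show thesis using that[of "max 0 L"] by auto
qed

lemma abs_continuous_C1:
  fixes f f' :: "real \<Rightarrow> real"
  assumes "continuous_on {a..b} f'"
    "\<And>s. a \<le> s \<Longrightarrow> s \<le> b \<Longrightarrow> (f has_real_derivative f' s) (at s)"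
  shows "abs_continuous_on_interval a b (\<lambda>s. of_real (f s))"
proof -
  obtain L where "L \<ge> 0" "\<And>s t. a \<le> s \<Longrightarrow> s \<le> t \<Longrightarrow> t \<le> b \<Longrightarrow> \<bar>f t - f s\<bar> \<le> L * (t - s)"
    using lipschitz_of_continuous_deriv[OF assms] by blast
  then show ?thesis
    by (intro abs_continuous_lipschitz[of L]) (auto simp flip: of_real_diff)
qed

text \<open>The monotone part contributes at most its total increase, whatever the intervals are;
  only \<open>g\<close> has to supply a \<delta>. The splitting may change with \<epsilon>.\<close>

lemma abs_continuous_near_mono:
  fixes f :: "real \<Rightarrow> real"
  assumes "\<And>\<epsilon>. \<epsilon> > 0 \<Longrightarrow> \<exists>m g. mono m \<and> m b - m a < \<epsilon> \<and>
      abs_continuous_on_interval a b (\<lambda>s. of_real (g s)) \<and> (\<forall>s\<in>{a..b}. f s = m s + g s)"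
    "a \<le> b"
  shows "abs_continuous_on_interval a b (\<lambda>s. of_real (f s))"
  unfolding abs_continuous_on_interval_def
proof (intro allI impI)
  fix \<epsilon> :: real assume "\<epsilon> > 0"
  then have "\<epsilon> / 2 > 0" by simp
  then obtain m g where m: "mono m" "m b - m a < \<epsilon> / 2"
      "abs_continuous_on_interval a b (\<lambda>s. of_real (g s))" "\<And>s. s \<in> {a..b} \<Longrightarrow> f s = m s + g s"
    using assms(1) by meson
  then obtain d where d: "d > 0" "\<And>D. finite D \<and> (\<forall>(s, t)\<in>D. a \<le> s \<and> s \<le> t \<and> t \<le> b) \<and>
        disjoint_family_on (\<lambda>(s, t). {s<..<t}) D \<and> (\<Sum>(s, t)\<in>D. t - s) < d
        \<Longrightarrow> (\<Sum>(s, t)\<in>D. cmod (of_real (g t) - of_real (g s))) < \<epsilon> / 2"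
    using \<open>\<epsilon> / 2 > 0\<close> unfolding abs_continuous_on_interval_def by meson
  have "(\<Sum>(s, t)\<in>D. cmod (of_real (f t) - of_real (f s))) < \<epsilon>"
    if D: "finite D \<and> (\<forall>(s, t)\<in>D. a \<le> s \<and> s \<le> t \<and> t \<le> b) \<and>
        disjoint_family_on (\<lambda>(s, t). {s<..<t}) D \<and> (\<Sum>(s, t)\<in>D. t - s) < d" for D
  proof -
    have "(\<Sum>(s, t)\<in>D. cmod (of_real (f t) - of_real (f s)))
        \<le> (\<Sum>(s, t)\<in>D. (m t - m s) + cmod (of_real (g t) - of_real (g s)))"
    proof (intro sum_mono, clarify)
      fix s t assume "(s, t) \<in> D"
      then have st: "a \<le> s" "s \<le> t" "t \<le> b" using D by auto
      then have "m s \<le> m t" using m(1) by (simp add: monoD)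
      then show "cmod (complex_of_real (f t) - complex_of_real (f s)) \<le>
          m t - m s + cmod (complex_of_real (g t) - complex_of_real (g s))"
        using m(4) st unfolding of_real_diff[symmetric] norm_of_real by auto
    qed
    also have "\<dots> = (\<Sum>(s, t)\<in>D. m t - m s) + (\<Sum>(s, t)\<in>D. cmod (of_real (g t) - of_real (g s)))"
      by (simp add: split_beta sum.distrib)
    also have "(\<Sum>(s, t)\<in>D. m t - m s) \<le> m b - m a"
      using m(1) D assms(2) by (intro sum_increments_le) auto
    finally show ?thesis
      using m(2) d(2)[OF D] by simp
  qed
  then show "\<exists>\<delta>>0. \<forall>D. finite D \<and> (\<forall>(s, t)\<in>D. a \<le> s \<and> s \<le> t \<and> t \<le> b) \<and>
        disjoint_family_on (\<lambda>(s, t). {s<..<t}) D \<and> (\<Sum>(s, t)\<in>D. t - s) < \<delta>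
        \<longrightarrow> (\<Sum>(s, t)\<in>D. cmod (of_real (f t) - of_real (f s))) < \<epsilon>"
    using d(1) by blast
qed

text \<open>Near \<open>p\<close> the function \<open>f s + C * s\<close> increases, and by
  continuity it increases little over a short interval about \<open>p\<close>. There
  \<open>f\<close> is a monotone function of small variation plus a linear one, even if
  \<open>f'\<close> tends to infinity at \<open>p\<close>.\<close>

lemma abs_continuous_C1_off_point:
  fixes f f' :: "real \<Rightarrow> real"
  assumes cont: "continuous_on UNIV f"
    and cont': "continuous_on ({a..b} - {p}) f'"
    and deriv: "\<And>s. s \<in> {a..b} \<Longrightarrow> s \<noteq> p \<Longrightarrow> (f has_real_derivative f' s) (at s)"
    and low: "r > 0" "\<And>s. s \<in> {a..b} \<Longrightarrow> s \<noteq> p \<Longrightarrow> \<bar>s - p\<bar> < r \<Longrightarrow> f' s \<ge> - C"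
    and p: "a < p" "p < b" and "C \<ge> 0"
  shows "abs_continuous_on_interval a b (\<lambda>s. of_real (f s))"
proof (rule abs_continuous_near_mono)
  fix \<epsilon> :: real assume "\<epsilon> > 0"
  define m where "m = (\<lambda>s. f s + C * s)"
  have "isCont m p"
    using cont unfolding m_def by (auto intro!: continuous_intros simp: continuous_on_eq_continuous_at)
  then obtain d where d: "d > 0" "\<And>s. \<bar>s - p\<bar> < d \<Longrightarrow> \<bar>m s - m p\<bar> < \<epsilon> / 2"
    using half_gt_zero[OF \<open>\<epsilon> > 0\<close>] unfolding continuous_at_real_range real_norm_def by meson
  obtain \<eta> where \<eta>: "\<eta> > 0" "\<eta> < d" "\<eta> < r" "a < p - \<eta>" "p + \<eta> < b"
  proof -
    have "0 < Min {d, r, p - a, b - p}" using d low p by auto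
    then obtain x where x: "0 < x" "x < Min {d, r, p - a, b - p}" using dense by blast
    then show ?thesis by (intro that[of x]) auto
  qed
  define l u where "l = p - \<eta>" and "u = p + \<eta>"
  \<comment> \<open>Clamping makes \<open>m \<circ> cl\<close> monotone on the whole line and
    constant off \<open>{l..u}\<close>, so that all its increase happens near
    \<open>p\<close>.\<close>
  define cl where "cl = (\<lambda>s. max l (min u s))"
  have lu: "a < l" "l < p" "p < u" "u < b" using \<eta> by (auto simp: l_def u_def)
  have m_mono: "m s \<le> m t" if "l \<le> s" "s \<le> t" "t \<le> u" for s t
  proof -
    have *: "m s \<le> m t" if "l \<le> s" "s \<le> t" "t \<le> u" "p \<notin> {s<..<t}" for s t
    proof (rule DERIV_nonneg_imp_increasing_open[OF that(2)])
      fix x assume x: "s < x" "x < t"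
      then have "x \<in> {a..b}" "x \<noteq> p" "\<bar>x - p\<bar> < r"
        using that lu \<eta> by (auto simp: l_def u_def)
      then show "\<exists>y. (m has_real_derivative y) (at x) \<and> 0 \<le> y"
        using low(2)[of x] unfolding m_def
        by (intro exI[of _ "f' x + C"] conjI) (auto intro!: derivative_eq_intros deriv)
    qed (use cont in \<open>auto simp: m_def intro!: continuous_intros intro: continuous_on_subset\<close>)
    show ?thesis
      using *[of s t] *[of s p] *[of p t] that lu by (cases "p \<in> {s<..<t}") auto
  qed
  have "mono (m \<circ> cl)"
    using lu by (auto simp: mono_def cl_def intro!: m_mono)
  moreover have "(m \<circ> cl) b - (m \<circ> cl) a < \<epsilon>"
  proof -
    have "cl a = l" "cl b = u" using lu by (auto simp: cl_def)
    moreover have "\<bar>m l - m p\<bar> < \<epsilon> / 2" "\<bar>m u - m p\<bar> < \<epsilon> / 2"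
      using d(2)[of l] d(2)[of u] \<eta> by (simp_all add: l_def u_def)
    moreover have "m u - m p < \<epsilon> / 2" "m p - m l < \<epsilon> / 2"
      using calculation(3,4) by linarith+
    ultimately show ?thesis by simp
  qed
  \<comment> \<open>Off \<open>{l..u}\<close> the remainder differs from \<open>f\<close> by
    constants, and on \<open>{l..u}\<close> it is \<open>- C * s\<close>; it is Lipschitz on each of
    the three pieces, hence on \<open>{a..b}\<close>.\<close>
  moreover define g where "g = (\<lambda>s. f s - (m \<circ> cl) s)"
  have "abs_continuous_on_interval a b (\<lambda>s. of_real (g s))"
  proof -
    obtain L1 where L1: "L1 \<ge> 0" "\<And>s t. a \<le> s \<Longrightarrow> s \<le> t \<Longrightarrow> t \<le> l \<Longrightarrow> \<bar>f t - f s\<bar> \<le> L1 * (t - s)"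
      by (rule lipschitz_of_continuous_deriv[of a l f' f])
         (use lu in \<open>auto intro!: deriv intro: continuous_on_subset[OF cont']\<close>)
    obtain L2 where L2: "L2 \<ge> 0" "\<And>s t. u \<le> s \<Longrightarrow> s \<le> t \<Longrightarrow> t \<le> b \<Longrightarrow> \<bar>f t - f s\<bar> \<le> L2 * (t - s)"
      by (rule lipschitz_of_continuous_deriv[of u b f' f])
         (use lu in \<open>auto intro!: deriv intro: continuous_on_subset[OF cont']\<close>)
    define L where "L = L1 + L2 + C"
    have L: "L \<ge> 0" "L1 \<le> L" "L2 \<le> L" "C \<le> L" using L1 L2 \<open>C \<ge> 0\<close> by (auto simp: L_def)
    have left: "\<bar>g t - g s\<bar> \<le> L * (t - s)" if "a \<le> s" "s \<le> t" "t \<le> l" for s t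
    proof -
      have "g t - g s = f t - f s" using that lu by (simp add: g_def cl_def)
      then show ?thesis
        using L1(2)[OF that] mult_right_mono[OF L(2), of "t - s"] that by simp
    qed
    have right: "\<bar>g t - g s\<bar> \<le> L * (t - s)" if "u \<le> s" "s \<le> t" "t \<le> b" for s t
    proof -
      have "g t - g s = f t - f s" using that lu by (simp add: g_def cl_def)
      then show ?thesis
        using L2(2)[OF that] mult_right_mono[OF L(3), of "t - s"] that by simp
    qed
    have mid: "\<bar>g t - g s\<bar> \<le> L * (t - s)" if "l \<le> s" "s \<le> t" "t \<le> u" for s t
    proof -
      have "g t - g s = - C * (t - s)" using that lu by (simp add: g_def cl_def m_def algebra_simps)
      then show ?thesis
        using mult_right_mono[OF L(4), of "t - s"] \<open>C \<ge> 0\<close> that by (simp add: abs_mult)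
    qed
    have midright: "\<bar>g t - g s\<bar> \<le> L * (t - s)" if "l \<le> s" "s \<le> t" "t \<le> b" for s t
      using mid[of s t] right[of s t] mid[of s u] right[of u t] that
      by (cases "t \<le> u"; cases "s \<le> u") (auto simp: algebra_simps)
    have "\<bar>g t - g s\<bar> \<le> L * (t - s)" if "a \<le> s" "s \<le> t" "t \<le> b" for s t
      using left[of s t] midright[of s t] left[of s l] midright[of l t] that lu
      by (cases "t \<le> l"; cases "s \<le> l") (auto simp: algebra_simps)
    then show ?thesis
      using L(1) by (intro abs_continuous_lipschitz[of L]) (auto simp flip: of_real_diff)
  qed
  moreover have "\<forall>s\<in>{a..b}. f s = (m \<circ> cl) s + g s" by (simp add: g_def)
  ultimately show "\<exists>m g. mono m \<and> m b - m a < \<epsilon> \<and>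
      abs_continuous_on_interval a b (\<lambda>s. of_real (g s)) \<and> (\<forall>s\<in>{a..b}. f s = m s + g s)"
    by blast
qed (use p in simp)

lemma abs_continuous_subinterval:
  assumes "abs_continuous_on_interval a b f" "a \<le> c" "d \<le> b"
  shows "abs_continuous_on_interval c d f"
  unfolding abs_continuous_on_interval_def
proof (intro allI impI)
  fix \<epsilon> :: real assume "\<epsilon> > 0"
  then obtain \<delta> where \<delta>: "\<delta> > 0" "\<And>D. finite D \<and> (\<forall>(s, t)\<in>D. a \<le> s \<and> s \<le> t \<and> t \<le> b) \<and>
        disjoint_family_on (\<lambda>(s, t). {s<..<t}) D \<and> (\<Sum>(s, t)\<in>D. t - s) < \<delta>
        \<Longrightarrow> (\<Sum>(s, t)\<in>D. cmod (f t - f s)) < \<epsilon>"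
    using assms(1) unfolding abs_continuous_on_interval_def by meson
  have sub: "\<forall>(s, t)\<in>D. a \<le> s \<and> s \<le> t \<and> t \<le> b" if "\<forall>(s, t)\<in>D. c \<le> s \<and> s \<le> t \<and> t \<le> d" for D
    using that assms(2,3) by fastforce
  show "\<exists>\<delta>>0. \<forall>D. finite D \<and> (\<forall>(s, t)\<in>D. c \<le> s \<and> s \<le> t \<and> t \<le> d) \<and>
        disjoint_family_on (\<lambda>(s, t). {s<..<t}) D \<and> (\<Sum>(s, t)\<in>D. t - s) < \<delta>
        \<longrightarrow> (\<Sum>(s, t)\<in>D. cmod (f t - f s)) < \<epsilon>"
  proof (intro exI[of _ \<delta>] conjI allI impI)
    fix D :: "(real \<times> real) set"
    assume "finite D \<and> (\<forall>(s, t)\<in>D. c \<le> s \<and> s \<le> t \<and> t \<le> d) \<and>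
        disjoint_family_on (\<lambda>(s, t). {s<..<t}) D \<and> (\<Sum>(s, t)\<in>D. t - s) < \<delta>"
    then show "(\<Sum>(s, t)\<in>D. cmod (f t - f s)) < \<epsilon>"
      using \<delta>(2)[of D] sub[of D] by blast
  qed (rule \<delta>(1))
qed

lemma abs_continuous_cong:
  assumes "abs_continuous_on_interval a b f" "\<And>s. a \<le> s \<Longrightarrow> s \<le> b \<Longrightarrow> f s = g s"
  shows "abs_continuous_on_interval a b g"
  by (rule abs_continuous_dominated[OF assms(1), of 1]) (use assms(2) in auto)

lemma abs_continuous_inverse:
  assumes "abs_continuous_on_interval a b f" "continuous_on {a..b} f" "\<And>s. s \<in> {a..b} \<Longrightarrow> f s \<noteq> 0"
  shows "abs_continuous_on_interval a b (\<lambda>s. 1 / f s)"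
proof -
  have "continuous_on {a..b} (\<lambda>s. 1 / f s)"
    using assms by (intro continuous_intros) auto
  then have "bounded ((\<lambda>s. 1 / f s) ` {a..b})"
    by (simp add: compact_continuous_image compact_imp_bounded)
  then obtain B where B: "B > 0" "\<And>s. s \<in> {a..b} \<Longrightarrow> norm (1 / f s) \<le> B"
    unfolding bounded_pos by blast
  show ?thesis
  proof (rule abs_continuous_dominated[OF assms(1), of "B * B"])
    fix s t assume st: "a \<le> s" "s \<le> t" "t \<le> b"
    then have "1 / f t - 1 / f s = - ((1 / f s) * (1 / f t) * (f t - f s))"
      using assms(3)[of s] assms(3)[of t] by (simp add: field_simps)
    then have "norm (1 / f t - 1 / f s) = norm (1 / f s) * norm (1 / f t) * norm (f t - f s)"
      by (simp only: norm_minus_cancel norm_mult)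
    also have "\<dots> \<le> B * B * norm (f t - f s)"
      using B(2)[of s] B(2)[of t] B(1) st by (intro mult_right_mono mult_mono) auto
    finally show "norm (1 / f t - 1 / f s) \<le> B * B * norm (f t - f s)" .
  qed simp
qed

section \<open>The homeomorphism of the line\<close>

text \<open>All cells of a generation are numbered by the integers, cell \<open>j\<close> splitting
  into \<open>3 * j\<close>, \<open>3 * j + 1\<close> and \<open>3 * j + 2\<close>. The grids of
  different \<open>q\<close> then correspond index by index, and the triadic one is
  \<open>j / 3 ^ n\<close>.\<close>

fun grid :: "(nat \<Rightarrow> real) \<Rightarrow> nat \<Rightarrow> int \<Rightarrow> real" where
  "grid q 0 j = of_int j"
| "grid q (Suc n) j = grid q n (j div 3) + (grid q n (j div 3 + 1) - grid q n (j div 3)) *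
     (if j mod 3 = 0 then 0 else if j mod 3 = 1 then (1 - q (Suc n)) / 2 else (1 + q (Suc n)) / 2)"

abbreviation grid_step :: "(nat \<Rightarrow> real) \<Rightarrow> nat \<Rightarrow> int \<Rightarrow> real" where
  "grid_step q n j \<equiv> grid q n (j + 1) - grid q n j"

lemma grid_child [simp]:
  "grid q (Suc n) (3 * i) = grid q n i"
  "grid q (Suc n) (3 * i + 1) = grid q n i + grid_step q n i * ((1 - q (Suc n)) / 2)"
  "grid q (Suc n) (3 * i + 2) = grid q n i + grid_step q n i * ((1 + q (Suc n)) / 2)"
  "grid q (Suc n) (3 * i + 3) = grid q n (i + 1)"
proof -
  have "(3 * i + 3) div 3 = i + 1" "(3 * i + 3) mod 3 = 0"
    "(3 * i + 2) div 3 = i" "(3 * i + 2) mod 3 = 2"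
    "(3 * i + 1) div 3 = i" "(3 * i + 1) mod 3 = 1" by presburger+
  then show "grid q (Suc n) (3 * i) = grid q n i"
    "grid q (Suc n) (3 * i + 1) = grid q n i + grid_step q n i * ((1 - q (Suc n)) / 2)"
    "grid q (Suc n) (3 * i + 2) = grid q n i + grid_step q n i * ((1 + q (Suc n)) / 2)"
    "grid q (Suc n) (3 * i + 3) = grid q n (i + 1)"
    by simp_all
qed

declare grid.simps(2) [simp del]

lemma grid_step_child:
  "grid_step q (Suc n) (3 * i) = grid_step q n i * ((1 - q (Suc n)) / 2)"
  "grid_step q (Suc n) (3 * i + 1) = grid_step q n i * q (Suc n)"
  "grid_step q (Suc n) (3 * i + 2) = grid_step q n i * ((1 - q (Suc n)) / 2)"
  using grid_child[of q n i] by (simp_all add: add.assoc) (simp_all add: field_simps)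

lemma mod_3_cases:
  fixes j :: int
  obtains i where "j = 3 * i" | i where "j = 3 * i + 1" | i where "j = 3 * i + 2"
proof -
  have "j = 3 * (j div 3) \<or> j = 3 * (j div 3) + 1 \<or> j = 3 * (j div 3) + 2" by presburger
  then show thesis using that by blast
qed

text \<open>For comparing points of different generations in a common refinement.\<close>

lemma grid_refine: "grid q (n + k) (3 ^ k * j) = grid q n j"
proof (induction k)
  case (Suc k)
  then show ?case using grid_child(1)[of q "n + k" "3 ^ k * j"] by (simp add: mult.assoc)
qed simp

lemma grid_one_third: "grid (\<lambda>n. 1 / 3) n j = of_int j / 3 ^ n"
proof (induction n arbitrary: j)
  case (Suc n)
  show ?case
    by (rule mod_3_cases[of j]) (simp_all only: grid_child Suc, simp_all add: field_simps)
qed simp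

lemma locate_grid: "\<exists>j. grid q n j \<le> x \<and> x < grid q n (j + 1)"
proof (induction n)
  case 0
  show ?case using floor_correct[of x] by (intro exI[of _ "\<lfloor>x\<rfloor>"]) simp
next
  case (Suc n)
  then obtain j where j: "grid q n j \<le> x" "x < grid q n (j + 1)" by blast
  let ?e = "grid q (Suc n)"
  have "?e (3 * j) \<le> x" "x < ?e (3 * j + 3)"
    using j by simp_all
  moreover have "3 * j + 1 + 1 = 3 * j + 2" "3 * j + 2 + 1 = 3 * j + 3" by simp_all
  moreover consider "x < ?e (3 * j + 1)" | "?e (3 * j + 1) \<le> x" "x < ?e (3 * j + 2)" | "?e (3 * j + 2) \<le> x"
    by linarith
  ultimately show ?case by metis
qed

section \<open>Stages of the Cantor set as grid cells whose ternary digits are 0 or 2\<close>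

fun cantor_addresses :: "nat \<Rightarrow> int set" where
  "cantor_addresses 0 = {0}"
| "cantor_addresses (Suc k) = (\<Union>j\<in>cantor_addresses k. {3 * j, 3 * j + 2})"

lemma cantor_intervals_grid:
  "cantor_intervals q k = (\<lambda>j. (grid q k j, grid q k (j + 1))) ` cantor_addresses k"
proof (induction k)
  case (Suc k)
  have "cantor_split (q (Suc k)) (grid q k j, grid q k (j + 1)) =
      (\<lambda>j. (grid q (Suc k) j, grid q (Suc k) (j + 1))) ` {3 * j, 3 * j + 2}" for j
    using grid_child[of q k j]
    by (simp add: cantor_split_def add.assoc) (simp add: algebra_simps add_divide_distrib diff_divide_distrib)
  then show ?case
    by (simp add: Suc image_UN)
qed simp

lemma cantor_stage_grid:
  "x \<in> cantor_stage q k \<longleftrightarrow> (\<exists>j\<in>cantor_addresses k. grid q k j \<le> x \<and> x \<le> grid q k (j + 1))"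
  by (auto simp: cantor_stage_def cantor_intervals_grid)

lemma finite_cantor_addresses: "finite (cantor_addresses k)"
  by (induction k) auto

lemma compact_random_cantor_set: "compact (random_cantor_set q)"
proof -
  have "closed (random_cantor_set q)"
    unfolding random_cantor_set_def cantor_stage_def cantor_intervals_grid
    by (intro closed_INT ballI closed_UN finite_imageI finite_cantor_addresses) auto
  \<comment> \<open>For arbitrary \<open>q\<close> a stage need not lie in \<open>{0..1}\<close>;
    the bound comes from the finitely many intervals of the first stage of the intersection.\<close>
  moreover have "random_cantor_set q \<subseteq> cantor_stage q 1"
    by (auto simp: random_cantor_set_def)
  moreover have "bounded (cantor_stage q 1)"
    unfolding cantor_stage_def cantor_intervals_grid
    by (intro bounded_UN finite_imageI finite_cantor_addresses) auto
  ultimately show ?thesis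
    by (meson bounded_subset compact_eq_bounded_closed)
qed

text \<open>The origin is the left end of the leftmost interval of every stage. Its membership keeps
  the pole of the coordinate \<open>1 / z\<close> out of the complement.\<close>

lemma zero_in_random_cantor_set:
  assumes "\<And>n. n \<ge> 1 \<Longrightarrow> q n < 1"
  shows "0 \<in> random_cantor_set q"
proof -
  have "0 \<in> cantor_addresses k \<and> grid q k 0 = 0 \<and> 0 < grid q k 1" for k
  proof (induction k)
    case (Suc k)
    have "grid q (Suc k) 0 = grid q k 0"
      "grid q (Suc k) 1 = grid q k 0 + grid_step q k 0 * ((1 - q (Suc k)) / 2)"
      using grid_child(1,2)[of q k 0] by simp_all
    moreover have "0 < grid q k 1 * ((1 - q (Suc k)) / 2)"
      using Suc assms[of "Suc k"] by (intro mult_pos_pos) auto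
    moreover have "0 \<in> cantor_addresses (Suc k)" using Suc by (auto intro: bexI[of _ 0])
    ultimately show ?case using Suc by (simp del: cantor_addresses.simps)
  qed simp
  then show ?thesis
    unfolding random_cantor_set_def cantor_stage_grid INT_iff
    by (intro ballI bexI[of _ 0]) (simp_all add: less_imp_le)
qed

text \<open>The increasing function that sends \<open>grid q n j\<close> to
  \<open>j / 3 ^ n\<close>. The supremum defines it at all points at once; that it takes the
  intended values on the grid rests on \<open>grid_le_imp\<close>.\<close>

definition grid_straightening :: "(nat \<Rightarrow> real) \<Rightarrow> real \<Rightarrow> real" where
  "grid_straightening q x = Sup {real_of_int j / 3 ^ n | n j. grid q n j \<le> x}"

section \<open>Cell lengths and the straightening map for bounded ratios\<close>

locale cantor_ratios =
  fixes q :: "nat \<Rightarrow> real" and \<delta> :: real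
  assumes \<delta>_pos: "0 < \<delta>"
    and ratio_bounds: "n \<ge> 1 \<Longrightarrow> \<delta> \<le> q n" "n \<ge> 1 \<Longrightarrow> q n \<le> 1 - \<delta>"
begin

abbreviation h :: "real \<Rightarrow> real" where "h \<equiv> grid_straightening q"

lemma \<delta>_le: "\<delta> \<le> 1 / 2"
  using ratio_bounds[of 1] by simp

lemma grid_step_pos: "grid_step q n j > 0"
proof (induction n arbitrary: j)
  case (Suc n)
  have "q (Suc n) > 0" "(1 - q (Suc n)) / 2 > 0"
    using ratio_bounds[of "Suc n"] \<delta>_pos by auto
  then show ?case
    by (cases j rule: mod_3_cases) (simp_all only: grid_step_child mult_pos_pos Suc)
qed simp

text \<open>The middle proportion lies between \<delta> and \<open>1 - \<delta>\<close>, the outer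
  ones between \<open>\<delta> / 2\<close> and \<open>(1 - \<delta>) / 2\<close>.\<close>

lemma grid_step_child_bounds:
  "\<delta> / 2 * grid_step q n i \<le> grid_step q (Suc n) j"
  "grid_step q (Suc n) j \<le> (1 - \<delta>) * grid_step q n i" if "j div 3 = i"
proof -
  have q: "\<delta> / 2 \<le> q (Suc n)" "\<delta> / 2 \<le> (1 - q (Suc n)) / 2"
    "q (Suc n) \<le> 1 - \<delta>" "(1 - q (Suc n)) / 2 \<le> 1 - \<delta>"
    using ratio_bounds[of "Suc n"] \<delta>_pos \<delta>_le by auto
  have "j = 3 * i \<or> j = 3 * i + 1 \<or> j = 3 * i + 2"
    using that by presburger
  then obtain c where "grid_step q (Suc n) j = grid_step q n i * c" "\<delta> / 2 \<le> c" "c \<le> 1 - \<delta>"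
    using q grid_step_child[of q n i] by metis
  then show "\<delta> / 2 * grid_step q n i \<le> grid_step q (Suc n) j"
    "grid_step q (Suc n) j \<le> (1 - \<delta>) * grid_step q n i"
    using grid_step_pos[of n i] mult_right_mono[of "\<delta> / 2" c "grid_step q n i"]
      mult_right_mono[of c "1 - \<delta>" "grid_step q n i"]
    by (simp_all only: mult.commute[of "grid_step q n i"] less_imp_le)
qed

text \<open>The two outer children of a cell carry the same ratio, so that for neighbouring cells with
  different parents the quotient of the lengths is that of the parents.\<close>

lemma grid_step_adjacent:
  "grid_step q n (j + 1) \<le> 2 / \<delta> * grid_step q n j \<and> grid_step q n j \<le> 2 / \<delta> * grid_step q n (j + 1)"
proof (induction n arbitrary: j)
  case 0
  then show ?case using \<delta>_pos \<delta>_le by (simp add: field_simps)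
next
  case (Suc n)
  define r where "r = (1 - q (Suc n)) / 2"
  \<comment> \<open>Both proportions lie in \<open>{\<delta> / 2..1}\<close>; this is the origin of
    the constant \<open>2 / \<delta>\<close>.\<close>
  have r: "r > 0" "q (Suc n) > 0" "r \<le> 2 / \<delta> * q (Suc n)" "q (Suc n) \<le> 2 / \<delta> * r"
  proof -
    have q: "\<delta> / 2 \<le> q (Suc n)" "\<delta> / 2 \<le> r" "q (Suc n) \<le> 1" "r \<le> 1"
      using ratio_bounds[of "Suc n"] \<delta>_pos \<delta>_le by (auto simp: r_def)
    then have "1 \<le> 2 / \<delta> * q (Suc n)" "1 \<le> 2 / \<delta> * r"
      using \<delta>_pos by (simp_all add: field_simps)
    then show "r > 0" "q (Suc n) > 0" "r \<le> 2 / \<delta> * q (Suc n)" "q (Suc n) \<le> 2 / \<delta> * r"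
      using q \<delta>_pos by linarith+
  qed
  have scale: "grid_step q n i * a \<le> 2 / \<delta> * (grid_step q n i * b)" if "a \<le> 2 / \<delta> * b" for i a b
    using mult_left_mono[OF that, of "grid_step q n i"] grid_step_pos[of n i]
    by (simp add: algebra_simps)
  note child = grid_step_child[of q n, folded r_def]
  show ?case
  proof (cases j rule: mod_3_cases)
    case (1 i)
    have "grid_step q (Suc n) j = grid_step q n i * r"
      "grid_step q (Suc n) (j + 1) = grid_step q n i * q (Suc n)"
      unfolding 1 by (simp_all only: child)
    then show ?thesis using scale[OF r(3)] scale[OF r(4)] by presburger
  next
    case (2 i)
    have eq: "3 * i + 1 + 1 = 3 * i + 2" by simp
    have "grid_step q (Suc n) j = grid_step q n i * q (Suc n)"
      "grid_step q (Suc n) (j + 1) = grid_step q n i * r"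
      unfolding 2 by (rule child(2)) (simp only: eq child(3))
    then show ?thesis using scale[OF r(3)] scale[OF r(4)] by presburger
  next
    case (3 i)
    have eq: "3 * i + 2 + 1 = 3 * (i + 1)" by simp
    have "grid_step q (Suc n) j = grid_step q n i * r"
      "grid_step q (Suc n) (j + 1) = grid_step q n (i + 1) * r"
      unfolding 3 by (rule child(3)) (simp only: eq child(1))
    moreover have "grid_step q n (i + 1) * r \<le> 2 / \<delta> * grid_step q n i * r"
      "grid_step q n i * r \<le> 2 / \<delta> * grid_step q n (i + 1) * r"
      by (rule mult_right_mono[OF conjunct1[OF Suc] less_imp_le[OF r(1)]]
          mult_right_mono[OF conjunct2[OF Suc] less_imp_le[OF r(1)]])+
    ultimately show ?thesis by (simp only: mult.assoc)
  qed
qed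

lemma grid_step_le: "grid_step q n j \<le> (1 - \<delta>) ^ n"
proof (induction n arbitrary: j)
  case (Suc n)
  have "grid_step q (Suc n) j \<le> (1 - \<delta>) * grid_step q n (j div 3)"
    by (rule grid_step_child_bounds) simp
  also have "\<dots> \<le> (1 - \<delta>) * (1 - \<delta>) ^ n"
    using Suc \<delta>_le by (intro mult_left_mono) auto
  finally show ?case by simp
qed simp

lemma grid_strict_mono: "i < j \<Longrightarrow> grid q n i < grid q n j"
proof (induction j rule: int_gr_induct)
  case base
  then show ?case using grid_step_pos[of n i] by simp
next
  case (step j)
  then show ?case using grid_step_pos[of n j] by simp
qed

lemma grid_less_iff [simp]: "grid q n i < grid q n j \<longleftrightarrow> i < j"
  by (metis grid_strict_mono linorder_less_linear order_less_asym)

lemma grid_le_iff [simp]: "grid q n i \<le> grid q n j \<longleftrightarrow> i \<le> j"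
  by (metis grid_less_iff not_less)

text \<open>Both points belong to generation \<open>n + m\<close>, with indices
  \<open>3 ^ m * i\<close> and \<open>3 ^ n * j\<close>, and within one generation the order of
  points is that of indices.\<close>

lemma grid_le_imp:
  assumes "grid q n i \<le> grid q m j"
  shows "of_int i / (3::real) ^ n \<le> of_int j / 3 ^ m"
proof -
  have "grid q (n + m) (3 ^ m * i) \<le> grid q (n + m) (3 ^ n * j)"
    using assms grid_refine[of q n m i] grid_refine[of q m n j] by (simp add: add.commute)
  then have "3 ^ m * i \<le> 3 ^ n * j" by simp
  then have "real_of_int (3 ^ m * i) \<le> real_of_int (3 ^ n * j)" by (simp only: of_int_le_iff)
  then show ?thesis by (simp add: field_simps)
qed

lemma h_ge: "of_int j / 3 ^ n \<le> h x" if "grid q n j \<le> x"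
  unfolding grid_straightening_def
proof (rule cSup_upper)
  show "bdd_above {real_of_int j / 3 ^ n |n j. grid q n j \<le> x}"
  proof (rule bdd_aboveI[of _ "of_int \<lceil>x\<rceil> / 3 ^ 0"], clarify)
    fix n j assume "grid q n j \<le> x"
    then have "grid q n j \<le> grid q 0 \<lceil>x\<rceil>" by simp linarith
    then show "real_of_int j / 3 ^ n \<le> real_of_int \<lceil>x\<rceil> / 3 ^ 0" by (rule grid_le_imp)
  qed
qed (use that in blast)

lemma h_le: "h x \<le> of_int j / 3 ^ n" if "x \<le> grid q n j"
  unfolding grid_straightening_def
proof (rule cSup_least)
  have "grid q 0 \<lfloor>x\<rfloor> \<le> x" by simp
  then show "{real_of_int j / 3 ^ n |n j. grid q n j \<le> x} \<noteq> {}" by blast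
next
  fix y assume "y \<in> {real_of_int j / 3 ^ n |n j. grid q n j \<le> x}"
  then obtain m i where "y = of_int i / 3 ^ m" "grid q m i \<le> x" by blast
  then show "y \<le> of_int j / 3 ^ n"
    using grid_le_imp[of m i n j] that by simp
qed

lemma h_grid [simp]: "h (grid q n j) = of_int j / 3 ^ n"
  by (intro antisym h_ge h_le) simp_all

text \<open>Cells become arbitrarily short, so a whole cell of some generation \<open>n\<close> fits
  between the two points, and \<open>h\<close> grows by \<open>1 / 3 ^ n\<close> across it.\<close>

lemma h_strict_mono: "strict_mono h"
proof (rule strict_monoI)
  fix x y :: real assume "x < y"
  have "(\<lambda>n. (1 - \<delta>) ^ n) \<longlonglongrightarrow> 0"
    using \<delta>_pos \<delta>_le by (intro LIMSEQ_realpow_zero) auto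
  then have "\<forall>\<^sub>F n in sequentially. (1 - \<delta>) ^ n < (y - x) / 2"
    using \<open>x < y\<close> by (intro order_tendstoD) auto
  then obtain n where n: "(1 - \<delta>) ^ n < (y - x) / 2"
    using eventually_happens trivial_limit_sequentially by blast
  obtain j where j: "grid q n j \<le> x" "x < grid q n (j + 1)"
    using locate_grid by blast
  have "grid q n (j + 1 + 1) \<le> y"
    using add_mono[OF grid_step_le[of n j] grid_step_le[of n "j + 1"]] n j by simp
  then have "of_int (j + 1 + 1) / 3 ^ n \<le> h y" by (rule h_ge)
  moreover have "h x \<le> of_int (j + 1) / 3 ^ n" using j by (intro h_le) simp
  moreover have "real_of_int (j + 1) / 3 ^ n < of_int (j + 1 + 1) / 3 ^ n"
    by (intro divide_strict_right_mono) auto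
  ultimately show "h x < h y" by linarith
qed

lemma h_le_iff: "h x \<le> of_int j / 3 ^ n \<longleftrightarrow> x \<le> grid q n j"
  using strict_mono_less_eq[OF h_strict_mono, of x "grid q n j"] by simp

lemma h_ge_iff: "of_int j / 3 ^ n \<le> h x \<longleftrightarrow> grid q n j \<le> x"
  using strict_mono_less_eq[OF h_strict_mono, of "grid q n j" x] by simp

lemma h_continuous: "continuous_on UNIV h"
proof -
  have "\<forall>x\<in>UNIV. isCont h x"
  proof
    fix x
    show "isCont h x"
      unfolding continuous_at_real_range real_norm_def
    proof (intro allI impI)
      fix \<epsilon> :: real assume "\<epsilon> > 0"
      obtain n where "(1 / 3) ^ n < \<epsilon> / 2"
        using real_arch_pow_inv[of "\<epsilon> / 2" "1 / 3"] \<open>\<epsilon> > 0\<close> by auto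
      then have n: "2 / 3 ^ n < \<epsilon>" by (simp add: power_divide)
      obtain j where j: "grid q n j \<le> x" "x < grid q n (j + 1)"
        using locate_grid by blast
      \<comment> \<open>\<open>x\<close> may be the left end of its cell, so the neighbourhood also
        reaches into cell \<open>j - 1\<close>; its image lies in two adjacent triadic
        cells.\<close>
      have "grid q n (j - 1) < x" using j(1) grid_less_iff[of n "j - 1" j] by linarith
      define d where "d = min (x - grid q n (j - 1)) (grid q n (j + 1) - x)"
      have "d > 0" using \<open>grid q n (j - 1) < x\<close> j by (simp add: d_def)
      moreover have "\<bar>h y - h x\<bar> < \<epsilon>" if "\<bar>y - x\<bar> < d" for y
      proof -
        have y: "grid q n (j - 1) \<le> y" "y \<le> grid q n (j + 1)"
          using that by (auto simp: d_def)
        have "of_int (j - 1) / 3 ^ n \<le> h y" "h y \<le> of_int (j + 1) / 3 ^ n"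
          "of_int j / 3 ^ n \<le> h x" "h x \<le> of_int (j + 1) / 3 ^ n"
          using y j by (simp_all only: h_le_iff h_ge_iff less_imp_le)
        then show ?thesis
          using n by (simp add: add_divide_distrib diff_divide_distrib)
      qed
      ultimately show "\<exists>d>0. \<forall>y. \<bar>y - x\<bar> < d \<longrightarrow> \<bar>h y - h x\<bar> < \<epsilon>" by blast
    qed
  qed
  then show ?thesis by (simp only: continuous_on_eq_continuous_at[OF open_UNIV])
qed

text \<open>\<open>h\<close> fixes the integers, the points of generation 0.\<close>

lemma h_close: "\<bar>h x - x\<bar> \<le> 1"
proof -
  have "of_int \<lfloor>x\<rfloor> / 3 ^ 0 \<le> h x" by (rule h_ge) simp
  moreover have "h x \<le> of_int (\<lfloor>x\<rfloor> + 1) / 3 ^ 0" by (rule h_le) simp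
  ultimately show ?thesis by simp linarith
qed

text \<open>\<open>h\<close> carries each cell to the triadic cell of the same index, and the
  addresses of the kept cells do not depend on the ratios.\<close>

lemma h_cantor_iff: "h x \<in> middle_third_cantor_set \<longleftrightarrow> x \<in> random_cantor_set q"
  unfolding middle_third_cantor_set_def random_cantor_set_def
  by (simp add: cantor_stage_grid grid_one_third h_le_iff h_ge_iff
      del: of_int_add)

text \<open>The scale \<open>t\<close> is matched with a generation \<open>n\<close> in which the
  cell of \<open>x\<close> has length at least \<open>2 / \<delta> * t\<close>. Its neighbours then
  have length at least \<open>t\<close>, so \<open>x + t\<close> and \<open>x - t\<close> stay
  within them. After \<open>1 + m\<close> further generations the cells are so short that a whole
  neighbouring cell fits on either side. Both increments are thus governed by the same
  \<open>n\<close>. The first conjunct limits \<open>n\<close> from above.\<close>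

lemma h_increment_bounds_small:
  assumes t: "0 < t" "2 / \<delta> * t \<le> 1" and m: "(1 - \<delta>) ^ m * (2 / \<delta>) \<le> 1 / (1 + 2 / \<delta>)"
  shows "\<exists>n. 2 / \<delta> * t \<le> (1 - \<delta>) ^ n \<and> h (x + t) - h x \<in> {1 / 3 ^ (n + 1 + m)..2 / 3 ^ n} \<and>
    h x - h (x - t) \<in> {1 / 3 ^ (n + 1 + m)..2 / 3 ^ n}"
proof -
  define \<Lambda> where "\<Lambda> = 2 / \<delta>"
  have \<Lambda>: "\<Lambda> > 0" using \<delta>_pos by (simp add: \<Lambda>_def)
  define P where "P n \<longleftrightarrow> (\<exists>j. grid q n j \<le> x \<and> x < grid q n (j + 1) \<and> \<Lambda> * t \<le> grid_step q n j)" for n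
  have "P 0"
    using t unfolding P_def \<Lambda>_def by (intro exI[of _ "\<lfloor>x\<rfloor>"]) (simp add: floor_correct[simplified])
  moreover obtain n1 where "(1 - \<delta>) ^ n1 < \<Lambda> * t"
    using real_arch_pow_inv[of "\<Lambda> * t" "1 - \<delta>"] \<delta>_pos \<delta>_le \<Lambda> t by auto
  then have "\<not> P n1"
    unfolding P_def using grid_step_le[of n1] by (meson less_le_not_le order_trans)
  \<comment> \<open>A generation whose cell at \<open>x\<close> is long enough while that of the
    next generation is not.\<close>
  ultimately obtain n where n: "P n" "\<not> P (Suc n)"
    by (metis nat_induct)
  obtain j where j: "grid q n j \<le> x" "x < grid q n (j + 1)" "\<Lambda> * t \<le> grid_step q n j"
    using n(1) by (auto simp: P_def)
  have adj: "grid_step q k (i + 1) \<le> \<Lambda> * grid_step q k i" "grid_step q k i \<le> \<Lambda> * grid_step q k (i + 1)" for k i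
    using grid_step_adjacent[of k i] by (auto simp: \<Lambda>_def)
  have "\<Lambda> * t \<le> \<Lambda> * grid_step q n (j + 1)" "\<Lambda> * t \<le> \<Lambda> * grid_step q n (j - 1)"
    using j(3) adj(2)[of n j] adj(1)[of n "j - 1"] by simp_all
  then have "t \<le> grid_step q n (j + 1)" "t \<le> grid_step q n (j - 1)"
    using \<Lambda> by (simp_all only: mult_le_cancel_left_pos)
  then have "x + t \<le> grid q n (j + 1 + 1)" "grid q n (j - 1) \<le> x - t"
    using j by simp_all
  then have upper: "h (x + t) \<le> of_int (j + 1 + 1) / 3 ^ n" "of_int (j - 1) / 3 ^ n \<le> h (x - t)"
      "of_int j / 3 ^ n \<le> h x" "h x \<le> of_int (j + 1) / 3 ^ n"
    using j by (simp_all only: h_le_iff h_ge_iff less_imp_le)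
  \<comment> \<open>The failure of \<open>P (Suc n)\<close> bounds the cell of \<open>x\<close> in
    that generation by \<open>\<Lambda> * t\<close>, and each further generation gains a factor
    \<open>1 - \<delta>\<close>.\<close>
  have small: "grid_step q (Suc n + k) i \<le> (1 - \<delta>) ^ k * (\<Lambda> * t)"
    if "grid q (Suc n + k) i \<le> x" "x < grid q (Suc n + k) (i + 1)" for k i
    using that
  proof (induction k arbitrary: i)
    case 0
    then show ?case using n(2) unfolding P_def by (auto simp: not_le less_imp_le)
  next
    case (Suc k)
    let ?N = "Suc n + k" and ?p = "i div 3"
    have "grid q (Suc ?N) (3 * ?p) \<le> grid q (Suc ?N) i"
      "grid q (Suc ?N) (i + 1) \<le> grid q (Suc ?N) (3 * ?p + 3)"
      unfolding grid_le_iff by presburger+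
    then have "grid q ?N ?p \<le> x" "x < grid q ?N (?p + 1)"
      using Suc.prems by simp_all
    then have "grid_step q ?N ?p \<le> (1 - \<delta>) ^ k * (\<Lambda> * t)" by (rule Suc.IH)
    then have "(1 - \<delta>) * grid_step q ?N ?p \<le> (1 - \<delta>) * ((1 - \<delta>) ^ k * (\<Lambda> * t))"
      using \<delta>_le by (intro mult_left_mono) auto
    moreover have "grid_step q (Suc ?N) i \<le> (1 - \<delta>) * grid_step q ?N ?p"
      by (rule grid_step_child_bounds) simp
    ultimately show ?case by (simp add: mult.assoc)
  qed
  define N where "N = n + 1 + m"
  obtain i where i: "grid q N i \<le> x" "x < grid q N (i + 1)"
    using locate_grid by blast
  \<comment> \<open>The choice of \<open>m\<close> absorbs two factors: \<Lambda> from the bound on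
    the cell, and \<open>1 + \<Lambda>\<close> because the cell together with a neighbour has to fit
    into length \<open>t\<close>.\<close>
  have "grid_step q N i \<le> (1 - \<delta>) ^ m * \<Lambda> * t"
    using small[of m i] i by (simp add: N_def mult.assoc)
  also have "\<dots> \<le> 1 / (1 + \<Lambda>) * t"
    using m t by (intro mult_right_mono) (simp_all add: \<Lambda>_def)
  finally have "(1 + \<Lambda>) * grid_step q N i \<le> (1 + \<Lambda>) * (1 / (1 + \<Lambda>) * t)"
    using \<Lambda> by (intro mult_left_mono) auto
  also have "\<dots> = t"
    using \<Lambda> by (simp add: divide_simps)
  finally have "grid_step q N i + \<Lambda> * grid_step q N i \<le> t"
    by (simp add: distrib_right)
  then have "grid_step q N i + grid_step q N (i + 1) \<le> t" "grid_step q N i + grid_step q N (i - 1) \<le> t"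
    using adj(1)[of N i] adj(2)[of N "i - 1"] by simp_all
  then have "grid q N (i + 1 + 1) \<le> x + t" "x - t \<le> grid q N (i - 1)"
    using i by simp_all
  then have lower: "of_int (i + 1 + 1) / 3 ^ N \<le> h (x + t)" "h (x - t) \<le> of_int (i - 1) / 3 ^ N"
      "of_int i / 3 ^ N \<le> h x" "h x \<le> of_int (i + 1) / 3 ^ N"
    using i by (simp_all only: h_le_iff h_ge_iff less_imp_le)
  have "2 / \<delta> * t \<le> (1 - \<delta>) ^ n \<and> h (x + t) - h x \<in> {1 / 3 ^ N..2 / 3 ^ n} \<and>
      h x - h (x - t) \<in> {1 / 3 ^ N..2 / 3 ^ n}"
    using upper lower order_trans[OF j(3) grid_step_le[of n j]] unfolding \<Lambda>_def
    by (simp add: add_divide_distrib diff_divide_distrib)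
  then show ?thesis unfolding N_def by blast
qed

text \<open>Cell comparison covers \<open>t \<le> \<delta> / 2\<close>. For larger \<open>t\<close>
  there is no coarser generation to use; monotonicity carries the lower bound up from
  \<open>\<delta> / 2\<close>, and closeness to the identity gives the rest.\<close>

lemma h_quasisymmetric:
  obtains M where "M \<ge> 1" "\<And>x t. t > 0 \<Longrightarrow> h (x + t) - h x \<le> M * (h x - h (x - t))"
    "\<And>x t. t > 0 \<Longrightarrow> h x - h (x - t) \<le> M * (h (x + t) - h x)"
proof -
  define \<Lambda> where "\<Lambda> = 2 / \<delta>"
  have \<Lambda>: "\<Lambda> \<ge> 4" using \<delta>_pos \<delta>_le by (simp add: \<Lambda>_def field_simps)
  obtain m where "(1 - \<delta>) ^ m < 1 / ((1 + \<Lambda>) * \<Lambda>)"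
    using real_arch_pow_inv[of "1 / ((1 + \<Lambda>) * \<Lambda>)" "1 - \<delta>"] \<delta>_pos \<delta>_le \<Lambda> by auto
  then have m: "(1 - \<delta>) ^ m * \<Lambda> \<le> 1 / (1 + \<Lambda>)"
    using mult_right_mono[of "(1 - \<delta>) ^ m" "1 / ((1 + \<Lambda>) * \<Lambda>)" \<Lambda>] \<Lambda> by simp
  note small = h_increment_bounds_small[folded \<Lambda>_def, OF _ _ m]
  have mono: "h x \<le> h y" if "x \<le> y" for x y
    using h_strict_mono that by (simp add: strict_mono_less_eq)
  \<comment> \<open>\<open>3 ^ (1 + m)\<close> comes from the gap between the two generations at
    small scales. The factor 6 bounds \<open>t + 2\<close> for \<open>t \<le> 4\<close>, and it
    exceeds both the 2 of the small-scale bound and \<open>(t + 2) / (t - 2)\<close> for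
    \<open>t > 4\<close>.\<close>
  define M :: real where "M = 6 * 3 ^ (1 + m)"
  have "(1::real) \<le> 3 ^ (1 + m)" by (rule one_le_power) simp
  then have M: "M \<ge> 6" by (simp add: M_def)
  have large: "h (x + t) - h x \<in> {max (1 / 3 ^ (1 + m)) (t - 2)..t + 2}"
    "h x - h (x - t) \<in> {max (1 / 3 ^ (1 + m)) (t - 2)..t + 2}" if "1 < \<Lambda> * t" for x t
  proof -
    have "\<exists>n. 1 \<le> (1 - \<delta>) ^ n \<and> h (x + 1 / \<Lambda>) - h x \<in> {1 / 3 ^ (n + 1 + m)..2 / 3 ^ n} \<and>
        h x - h (x - 1 / \<Lambda>) \<in> {1 / 3 ^ (n + 1 + m)..2 / 3 ^ n}"
      using small[of "1 / \<Lambda>" x] \<Lambda> by simp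
    then obtain n where n: "1 \<le> (1 - \<delta>) ^ n" "h (x + 1 / \<Lambda>) - h x \<ge> 1 / 3 ^ (n + 1 + m)"
        "h x - h (x - 1 / \<Lambda>) \<ge> 1 / 3 ^ (n + 1 + m)"
      by auto
    \<comment> \<open>At \<open>t = 1 / \<Lambda>\<close> the first conjunct reads
      \<open>1 \<le> (1 - \<delta>) ^ n\<close>, which leaves only generation 0, so the lower bound
      is the same for all \<open>x\<close>.\<close>
    have "n = 0"
      using n(1) power_less_one_iff[of "1 - \<delta>" n] \<delta>_pos \<delta>_le by (cases n) auto
    moreover have "1 / \<Lambda> \<le> t"
      using that \<Lambda> by (simp add: field_simps)
    then have "h (x + 1 / \<Lambda>) \<le> h (x + t)" "h (x - t) \<le> h (x - 1 / \<Lambda>)"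
      by (auto intro: mono)
    ultimately show "h (x + t) - h x \<in> {max (1 / 3 ^ (1 + m)) (t - 2)..t + 2}"
      "h x - h (x - t) \<in> {max (1 / 3 ^ (1 + m)) (t - 2)..t + 2}"
      using n h_close[of x] h_close[of "x + t"] h_close[of "x - t"] by (simp_all add: abs_le_iff)
  qed
  have cmp: "a \<le> M * b" if "b \<ge> c" "a \<le> 6 * 3 ^ (1 + m) * c" "c \<ge> 0" for a b c :: real
    using mult_left_mono[of c b M] that M unfolding M_def[symmetric] by linarith
  have *: "a \<le> M * b"
    if ab: "\<Lambda> * t \<le> 1 \<Longrightarrow> \<exists>n. a \<le> 2 / 3 ^ n \<and> 1 / 3 ^ (n + 1 + m) \<le> b"
      "1 < \<Lambda> * t \<Longrightarrow> a \<le> t + 2 \<and> t - 2 \<le> b \<and> 1 / 3 ^ (1 + m) \<le> b"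
    for a b t :: real
  proof (cases "\<Lambda> * t \<le> 1")
    case True
    then obtain n where "a \<le> 2 / 3 ^ n" "1 / 3 ^ (n + 1 + m) \<le> b" using ab(1) by blast
    moreover have "(2::real) / 3 ^ n \<le> 6 * 3 ^ (1 + m) * (1 / 3 ^ (n + 1 + m))"
      by (simp add: power_add field_simps)
    ultimately show ?thesis by (intro cmp[of "1 / 3 ^ (n + 1 + m)" b a]) auto
  next
    case False
    then have ab: "a \<le> t + 2" "t - 2 \<le> b" "1 / 3 ^ (1 + m) \<le> b" using ab(2) by auto
    show ?thesis
    proof (cases "t \<le> 4")
      case True
      then show ?thesis using ab by (intro cmp[of "1 / 3 ^ (1 + m)" b a]) auto
    next
      case False
      then have "a \<le> 6 * b" "0 \<le> b" using ab by auto
      then show ?thesis using mult_right_mono[OF M, of b] by linarith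
    qed
  qed
  show thesis
  proof (rule that[of M])
    show "M \<ge> 1" using M by simp
    show "h (x + t) - h x \<le> M * (h x - h (x - t))" if "t > 0" for x t
      by (rule *[of t]) (use small[of t x] large[of t x] that in auto)
    show "h x - h (x - t) \<le> M * (h (x + t) - h x)" if "t > 0" for x t
      by (rule *[of t]) (use small[of t x] large[of t x] that in auto)
  qed
qed

end

section \<open>The Beurling--Ahlfors extension\<close>

locale quasisymmetric_line_map =
  fixes h :: "real \<Rightarrow> real" and M :: real
  assumes cont: "continuous_on UNIV h"
    and strict_mono: "strict_mono h"
    and close_id: "\<bar>h x - x\<bar> \<le> 1"
    and M_ge_1: "M \<ge> 1"
    and quasisymmetric: "t > 0 \<Longrightarrow> h (x + t) - h x \<le> M * (h x - h (x - t))"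
      "t > 0 \<Longrightarrow> h x - h (x - t) \<le> M * (h (x + t) - h x)"
begin

text \<open>An antiderivative of \<open>h\<close>: means of \<open>h\<close> are difference
  quotients of \<open>H\<close>, and their derivatives follow from the quotient rule.\<close>

definition H :: "real \<Rightarrow> real" where
  "H = (SOME G. \<forall>x. (G has_real_derivative h x) (at x))"

text \<open>The mean of \<open>h\<close> over the segment between \<open>Re z\<close> and
  \<open>Re z + Im z\<close>, for either sign of \<open>Im z\<close>; conjugation passes to the
  segment on the other side of \<open>Re z\<close>.\<close>

definition avg :: "complex \<Rightarrow> real" where
  "avg z = (if Im z = 0 then h (Re z) else (H (Re z + Im z) - H (Re z)) / Im z)"

text \<open>This and \<open>avg_y\<close> are the partial derivatives of \<open>avg\<close> off the
  real axis, see \<open>has_derivative_avg\<close>.\<close>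

definition avg_x :: "complex \<Rightarrow> real" where
  "avg_x z = (h (Re z + Im z) - h (Re z)) / Im z"

definition avg_y :: "complex \<Rightarrow> real" where
  "avg_y z = (h (Re z + Im z) - avg z) / Im z"

text \<open>For \<open>Im z > 0\<close> the two terms are the averages of \<open>h\<close> over \<open>{x..x + y}\<close> and \<open>{x - y..x}\<close>,
  so this is the Beurling--Ahlfors extension of \<open>h\<close>, up to a factor in the imaginary part; it
  commutes with complex conjugation.\<close>

definition extension :: "complex \<Rightarrow> complex" where
  "extension z = (1 + \<i>) / 2 * of_real (avg z) + (1 - \<i>) / 2 * of_real (avg (cnj z))"

lemma h_less: "x < y \<Longrightarrow> h x < h y"
  using strict_mono by (rule strict_monoD)

lemma DERIV_H: "(H has_real_derivative h x) (at x)"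
proof -
  have "isCont h x" for x
    using cont by (simp add: continuous_on_eq_continuous_at)
  then obtain G where "\<And>x. (G has_vector_derivative h x) (at x)"
    using einterval_antiderivative[of "-\<infinity>" "\<infinity>" h] by auto
  then have "\<exists>G. \<forall>x. (G has_real_derivative h x) (at x)"
    by (auto simp: has_real_derivative_iff_has_vector_derivative)
  then have "\<forall>x. (H has_real_derivative h x) (at x)"
    unfolding H_def by (rule someI_ex)
  then show ?thesis by blast
qed

lemma H_mean_value:
  assumes "x < y"
  obtains u where "x < u" "u < y" "H y - H x = (y - x) * h u"
  using MVT2[OF assms DERIV_H] by blast

lemma avg_mean_value:
  assumes "Im z \<noteq> 0"
  obtains u where "0 < u" "u < 1" "avg z = h (Re z + u * Im z)"
proof (cases "Im z > 0")
  case True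
  then obtain u where u: "Re z < u" "u < Re z + Im z" "H (Re z + Im z) - H (Re z) = Im z * h u"
    using H_mean_value[of "Re z" "Re z + Im z"] by auto
  show ?thesis
    using that[of "(u - Re z) / Im z"] u True by (simp add: avg_def)
next
  case False
  then have neg: "Im z < 0" using assms by simp
  then obtain u where u: "Re z + Im z < u" "u < Re z" "H (Re z) - H (Re z + Im z) = - Im z * h u"
    using H_mean_value[of "Re z + Im z" "Re z"] by auto
  then have "H (Re z + Im z) - H (Re z) = Im z * h u" by simp
  then have "avg z = h (Re z + (u - Re z) / Im z * Im z)"
    using neg by (simp add: avg_def)
  moreover have "0 < (u - Re z) / Im z" "(u - Re z) / Im z < 1"
    using u neg by (simp_all add: divide_neg_neg divide_less_eq)
  ultimately show ?thesis by (intro that[of "(u - Re z) / Im z"])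
qed

text \<open>Division by \<open>y\<close> makes the sign independent of the half-plane, so both are
  treated at once.\<close>

lemma h_affine_mono:
  assumes "y \<noteq> 0" "s < t"
  shows "0 < (h (x + t * y) - h (x + s * y)) / y"
proof (cases "y > 0")
  case True
  then have "x + s * y < x + t * y" using assms by simp
  then show ?thesis using h_less[of "x + s * y" "x + t * y"] True by simp
next
  case False
  then have "y < 0" using assms by simp
  then have "x + t * y < x + s * y" using assms by simp
  then show ?thesis using h_less[of "x + t * y" "x + s * y"] \<open>y < 0\<close> by (simp add: divide_neg_neg)
qed

lemma avg_x_pos: "Im z \<noteq> 0 \<Longrightarrow> avg_x z > 0"
  using h_affine_mono[of "Im z" 0 1 "Re z"] by (simp add: avg_x_def)

lemma avg_y_pos: "Im z \<noteq> 0 \<Longrightarrow> avg_y z > 0"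
  using h_affine_mono[of "Im z" _ 1 "Re z"] by (auto simp: avg_y_def elim!: avg_mean_value)

lemma avg_y_le: "Im z \<noteq> 0 \<Longrightarrow> avg_y z \<le> avg_x z"
proof -
  assume z: "Im z \<noteq> 0"
  then obtain u where u: "0 < u" "avg z = h (Re z + u * Im z)" using avg_mean_value by blast
  have "avg_x z - avg_y z = (h (Re z + u * Im z) - h (Re z + 0 * Im z)) / Im z"
    using u(2) by (simp add: avg_x_def avg_y_def diff_divide_distrib)
  then show ?thesis using h_affine_mono[OF z u(1), of "Re z"] by simp
qed

text \<open>Quasisymmetry at \<open>Re z\<close> with \<open>t = \<bar>Im z\<bar>\<close>: the two
  quotients are the increments of \<open>h\<close> on either side, divided by the same
  length.\<close>

lemma avg_x_cnj_le: "Im z \<noteq> 0 \<Longrightarrow> avg_x z \<le> M * avg_x (cnj z)"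
proof -
  assume z: "Im z \<noteq> 0"
  define x y where "x = Re z" and "y = Im z"
  have eq: "avg_x z = (h (x + y) - h x) / y" "M * avg_x (cnj z) = M * (h x - h (x - y)) / y"
    by (simp_all add: avg_x_def x_def y_def divide_simps) (simp_all add: algebra_simps)?
  show ?thesis
  proof (cases "y > 0")
    case True
    then show ?thesis
      using quasisymmetric(1)[of y x] unfolding eq by (intro divide_right_mono) auto
  next
    case False
    then have "y < 0" using z by (simp add: y_def)
    then show ?thesis
      using quasisymmetric(2)[of "- y" x] unfolding eq
      by (intro divide_right_mono_neg) (auto simp: algebra_simps)
  qed
qed

text \<open>The segment is halved; \<open>w\<close> and \<open>w'\<close> carry the means over the
  halves. On the first half \<open>h\<close> lies on the near side of its midpoint value, so
  \<open>avg_y z\<close> is at least half of \<open>a\<close>, the scaled increment over the second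
  half. Quasisymmetry at the midpoint bounds the other increment by \<open>M * a\<close>, whence
  \<open>avg_x z \<le> (1 + M) * a\<close>.\<close>

lemma avg_y_ge:
  assumes z: "Im z \<noteq> 0"
  shows "avg_x z / (2 * (1 + M)) \<le> avg_y z"
proof -
  define x y where "x = Re z" and "y = Im z"
  have y: "y \<noteq> 0" using z by (simp add: y_def)
  define w where "w = Complex x (y / 2)"
  define w' where "w' = Complex (x + y / 2) (y / 2)"
  have "avg z = (avg w + avg w') / 2"
  proof -
    have "x + y / 2 + y / 2 = x + y" by simp
    then have "avg w = (H (x + y / 2) - H x) / (y / 2)" "avg w' = (H (x + y) - H (x + y / 2)) / (y / 2)"
      using y unfolding avg_def w_def w'_def by (simp_all only: complex.sel) simp_all
    moreover have "avg z = (H (x + y) - H x) / y"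
      using y by (simp add: avg_def x_def y_def)
    ultimately show ?thesis by (simp add: diff_divide_distrib)
  qed
  then have sum: "avg_y z = (h (x + y) - avg w) / y / 2 + (h (x + y) - avg w') / y / 2"
    by (simp add: avg_y_def x_def y_def diff_divide_distrib add_divide_distrib)
  obtain u where u: "u < 1" "avg w = h (x + u * (y / 2))"
    using avg_mean_value[of w] y by (auto simp: w_def)
  moreover obtain u' where u': "u' < 1" "avg w' = h (x + y / 2 + u' * (y / 2))"
    using avg_mean_value[of w'] y by (auto simp: w'_def)
  have "avg_y z = (h (x + y) - h (x + u * (y / 2))) / y / 2
      + (h (x + y) - h (x + y / 2 + u' * (y / 2))) / y / 2"
    unfolding sum u(2) u'(2) by simp
  moreover have "0 < (h (x + y) - h (x + y / 2 + u' * (y / 2))) / y"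
    using h_affine_mono[of "y / 2" u' 1 "x + y / 2"] u'(1) y by (simp add: zero_less_divide_iff add.commute[of y x])
  moreover have "0 < (h (x + y / 2) - h (x + u * (y / 2))) / y"
    using h_affine_mono[of "y / 2" u 1 x] u(1) y by (simp add: zero_less_divide_iff)
  moreover define a where "a = (h (x + y) - h (x + y / 2)) / y"
  ultimately have "a / 2 \<le> avg_y z"
    by (simp add: diff_divide_distrib)
  moreover have "avg_x z \<le> (1 + M) * a"
  proof -
    define b where "b = (h (x + y / 2) - h x) / y"
    have "avg_x (cnj w') \<le> M * avg_x w'"
      using avg_x_cnj_le[of "cnj w'"] y by (simp add: w'_def)
    moreover have "x + y / 2 + y / 2 = x + y" "x + y / 2 + - (y / 2) = x" by simp_all
    then have "avg_x w' = 2 * a" "avg_x (cnj w') = 2 * b"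
      by (simp_all only: avg_x_def w'_def a_def b_def complex.sel complex_cnj)
         (simp_all add: diff_divide_distrib mult.commute)
    ultimately have "b \<le> M * a" by simp
    moreover have "avg_x z = a + b"
      by (simp add: avg_x_def a_def b_def x_def y_def diff_divide_distrib)
    ultimately show ?thesis by (simp add: distrib_right)
  qed
  ultimately have "avg_x z \<le> (1 + M) * (2 * avg_y z)"
    using mult_left_mono[of a "2 * avg_y z" "1 + M"] M_ge_1 by linarith
  then show ?thesis
    using M_ge_1 by (simp add: pos_divide_le_eq algebra_simps)
qed

lemma has_derivative_avg:
  assumes "Im z \<noteq> 0"
  shows "(avg has_derivative (\<lambda>\<zeta>. avg_x z * Re \<zeta> + avg_y z * Im \<zeta>)) (at z)"
proof (rule has_derivative_transform_within_open)
  show "open {w. Im w \<noteq> 0}" by (intro open_Collect_neq continuous_intros)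
  have 1: "((\<lambda>w. H (Re w + Im w)) has_derivative (\<lambda>\<zeta>. (Re \<zeta> + Im \<zeta>) * h (Re z + Im z))) (at z)"
    by (rule DERIV_compose_FDERIV[OF DERIV_H]) (auto intro!: derivative_eq_intros)
  have 2: "((\<lambda>w. H (Re w)) has_derivative (\<lambda>\<zeta>. Re \<zeta> * h (Re z))) (at z)"
    by (rule DERIV_compose_FDERIV[OF DERIV_H]) (auto intro!: derivative_eq_intros)
  show "((\<lambda>w. (H (Re w + Im w) - H (Re w)) / Im w) has_derivative
      (\<lambda>\<zeta>. avg_x z * Re \<zeta> + avg_y z * Im \<zeta>)) (at z)"
    by (rule has_derivative_eq_rhs[OF has_derivative_divide'[OF has_derivative_diff[OF 1 2] bounded_linear_imp_has_derivative[OF bounded_linear_Im] assms]])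
       (use assms in \<open>auto simp: avg_x_def avg_y_def avg_def fun_eq_iff divide_simps\<close>, simp add: algebra_simps)
qed (use assms in \<open>auto simp: avg_def\<close>)

text \<open>\<open>0 \<le> avg_y z \<le> avg_x z\<close> says that the mean lies between the values
  of \<open>h\<close> at the two ends. This gives continuity at the axis.\<close>

lemma abs_avg_minus_le: "\<bar>avg z - h (Re z)\<bar> \<le> \<bar>h (Re z + Im z) - h (Re z)\<bar>"
proof (cases "Im z = 0")
  case False
  then have "0 \<le> avg_y z" "avg_y z \<le> avg_x z"
    using avg_y_pos avg_y_le by (auto intro: less_imp_le)
  then have "\<bar>avg_x z - avg_y z\<bar> \<le> \<bar>avg_x z\<bar>"
    by simp
  moreover have "avg_x z - avg_y z = (avg z - h (Re z)) / Im z"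
    by (simp add: avg_x_def avg_y_def diff_divide_distrib)
  ultimately show ?thesis
    using False by (simp add: avg_x_def abs_divide divide_le_cancel)
qed (simp add: avg_def)

lemma continuous_avg: "continuous_on UNIV avg"
  unfolding continuous_on_eq_continuous_at[OF open_UNIV]
proof
  fix z
  show "isCont avg z"
  proof (cases "Im z = 0")
    case False
    then show ?thesis
      using has_derivative_avg has_derivative_continuous by blast
  next
    case True
    have h: "isCont h x" for x
      using cont by (simp add: continuous_on_eq_continuous_at)
    have "((\<lambda>w. avg w - h (Re w)) \<longlongrightarrow> 0) (at z)"
    proof (rule Lim_null_comparison)
      show "\<forall>\<^sub>F w in at z. norm (avg w - h (Re w)) \<le> \<bar>h (Re w + Im w) - h (Re w)\<bar>"
        using abs_avg_minus_le by simp
      have "((\<lambda>w. \<bar>h (Re w + Im w) - h (Re w)\<bar>) \<longlongrightarrow> \<bar>h (Re z + Im z) - h (Re z)\<bar>) (at z)"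
        by (intro tendsto_intros isCont_tendsto_compose[OF h])
      then show "((\<lambda>w. \<bar>h (Re w + Im w) - h (Re w)\<bar>) \<longlongrightarrow> 0) (at z)"
        using True by simp
    qed
    moreover have "((\<lambda>w. h (Re w)) \<longlongrightarrow> h (Re z)) (at z)"
      by (intro tendsto_intros isCont_tendsto_compose[OF h])
    ultimately have "((\<lambda>w. (avg w - h (Re w)) + h (Re w)) \<longlongrightarrow> 0 + h (Re z)) (at z)"
      by (rule tendsto_add)
    then show ?thesis
      using True by (simp add: isCont_def avg_def[of z])
  qed
qed

section \<open>Bijectivity of the extension\<close>

lemma avg_less_Re:
  assumes "x < x'"
  shows "avg (Complex x y) < avg (Complex x' y)"
proof (cases "y = 0")
  case True
  then show ?thesis using assms h_less by (simp add: avg_def)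
next
  case False
  show ?thesis
  proof (rule DERIV_pos_imp_increasing[OF assms])
    fix t
    have "((\<lambda>t. avg (Complex t y)) has_real_derivative avg_x (Complex t y)) (at t)"
      using False by (auto simp: avg_def avg_x_def intro!: derivative_eq_intros DERIV_H DERIV_H[THEN DERIV_shift[THEN iffD1]])
    then show "\<exists>d. ((\<lambda>t. avg (Complex t y)) has_real_derivative d) (at t) \<and> d > 0"
      using avg_x_pos False by force
  qed
qed

lemma avg_less_Im:
  assumes "y < y'"
  shows "avg (Complex x y) < avg (Complex x y')"
proof -
  \<comment> \<open>\<open>avg\<close> need not be differentiable on the axis, so a segment crossing
    it is cut at 0 and continuity is used at the cut.\<close>
  have *: "avg (Complex x y) < avg (Complex x y')" if "y < y'" "0 \<notin> {y<..<y'}" for y y'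
  proof (rule DERIV_pos_imp_increasing_open[OF that(1)])
    fix t assume "y < t" "t < y'"
    then have t: "t \<noteq> 0" using that by auto
    then have d1: "(avg has_derivative (\<lambda>\<zeta>. avg_x (Complex x t) * Re \<zeta> + avg_y (Complex x t) * Im \<zeta>))
        (at (Complex x t))"
      by (intro has_derivative_avg) simp
    have "Complex x = (\<lambda>s. of_real x + \<i> * of_real s)"
      by (simp add: fun_eq_iff Complex_eq)
    then have d2: "(Complex x has_derivative (\<lambda>s. Complex 0 s)) (at t)"
      by (auto intro!: derivative_eq_intros simp: Complex_eq)
    have "((\<lambda>t. avg (Complex x t)) has_derivative (\<lambda>s. avg_y (Complex x t) * s)) (at t)"
      using has_derivative_compose[OF d2 d1] by simp
    then have "((\<lambda>t. avg (Complex x t)) has_real_derivative avg_y (Complex x t)) (at t)"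
      by (simp add: has_field_derivative_def)
    then show "\<exists>d. ((\<lambda>t. avg (Complex x t)) has_real_derivative d) (at t) \<and> d > 0"
      using avg_y_pos t by force
  next
    have "continuous_on UNIV (\<lambda>t. avg (Complex x t))"
      by (intro continuous_on_compose2[OF continuous_avg] continuous_intros) auto
    then show "continuous_on {y..y'} (\<lambda>t. avg (Complex x t))"
      by (rule continuous_on_subset) simp
  qed
  show ?thesis
    using *[of y y'] *[of y 0] *[of 0 y'] assms by (cases "0 \<in> {y<..<y'}") auto
qed

lemma extension_eq: "extension z = Complex ((avg z + avg (cnj z)) / 2) ((avg z - avg (cnj z)) / 2)"
  by (simp add: extension_def complex_eq_iff field_simps)

text \<open>\<open>avg\<close> increases strictly in both coordinates. If
  \<open>Re z < Re w\<close>, equality of the means at \<open>z\<close> and \<open>w\<close> forces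
  \<open>Im w < Im z\<close>, while equality at the conjugates forces
  \<open>- Im w < - Im z\<close>.\<close>

lemma inj_extension: "inj extension"
proof (rule injI)
  fix z w assume "extension z = extension w"
  then have eq: "avg z = avg w" "avg (cnj z) = avg (cnj w)"
    by (auto simp: extension_eq)
  have False if eq: "avg z = avg w" "avg (cnj z) = avg (cnj w)" and "Re z < Re w" for z w
  proof -
    have mono: "avg (Complex (Re w) s) < avg (Complex (Re w) t) \<Longrightarrow> s < t" for s t
      using avg_less_Im[of t s "Re w"] by (cases s t rule: linorder_cases) auto
    have cnj: "cnj z = Complex (Re z) (- Im z)" for z
      by (simp add: complex_eq_iff)
    have "avg (Complex (Re w) (Im z)) > avg z"
      "avg (Complex (Re w) (- Im z)) > avg (cnj z)"
      using avg_less_Re[OF \<open>Re z < Re w\<close>, of "Im z"]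
        avg_less_Re[OF \<open>Re z < Re w\<close>, of "- Im z"] by (simp_all add: cnj)
    moreover have "avg (Complex (Re w) (Im w)) = avg w" by simp
    moreover have "avg (Complex (Re w) (- Im w)) = avg (cnj w)" by (simp only: cnj)
    ultimately have "avg (Complex (Re w) (Im w)) < avg (Complex (Re w) (Im z))"
      "avg (Complex (Re w) (- Im w)) < avg (Complex (Re w) (- Im z))"
      using eq by linarith+
    from mono[OF this(1)] mono[OF this(2)]
    show False by simp
  qed
  from this[OF eq] this[of w z] have "Re z = Re w"
    using eq by (metis linorder_less_linear)
  moreover have "avg (Complex (Re w) (Im z)) = avg (Complex (Re w) (Im w))"
    using eq(1) calculation by (metis complex_surj)
  then have "Im z = Im w"
    using avg_less_Im[of "Im z" "Im w" "Re w"] avg_less_Im[of "Im w" "Im z" "Re w"]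
    by (cases "Im z" "Im w" rule: linorder_cases) auto
  ultimately show "z = w" by (simp add: complex_eq_iff)
qed

lemma continuous_extension: "continuous_on UNIV extension"
  unfolding extension_def
  by (intro continuous_intros continuous_on_compose2[OF continuous_avg]) auto

lemma extension_of_real: "extension (of_real x) = of_real (h x)"
  by (simp add: extension_eq avg_def complex_eq_iff)

lemma extension_real_iff: "extension z \<in> of_real ` T \<longleftrightarrow> z \<in> of_real ` (h -` T)"
proof (cases "Im z = 0")
  case True
  then have "z = of_real (Re z)" by (simp add: complex_eq_iff)
  then obtain x where "z = of_real x" by blast
  then show ?thesis by (auto simp: extension_of_real image_iff)
next
  case False
  have "avg z \<noteq> avg (cnj z)"
  proof -
    have "cnj z = Complex (Re z) (- Im z)" "z = Complex (Re z) (Im z)"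
      by (simp_all add: complex_eq_iff)
    then show ?thesis
      using avg_less_Im[of "Im z" "- Im z" "Re z"] avg_less_Im[of "- Im z" "Im z" "Re z"] False
      by (metis linorder_less_linear neg_0_equal_iff_equal equal_neg_zero order_less_irrefl)
  qed
  then have "Im (extension z) \<noteq> 0" by (simp add: extension_eq)
  then show ?thesis using False by auto
qed

text \<open>The mean of the identity over the segment is \<open>Re z + Im z / 2\<close>, and
  \<open>h\<close> differs from the identity by at most 1; \<open>G\<close> is an antiderivative of
  \<open>h t - t\<close>.\<close>

lemma abs_avg_minus_linear_le: "\<bar>avg z - (Re z + Im z / 2)\<bar> \<le> 1"
proof (cases "Im z = 0")
  case True
  then show ?thesis using close_id by (simp add: avg_def)
next
  case False
  define x y where "x = Re z" and "y = Im z"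
  define G where "G = (\<lambda>t. H t - t\<^sup>2 / 2)"
  have G: "(G has_real_derivative h t - t) (at t)" for t
    unfolding G_def by (auto intro!: derivative_eq_intros DERIV_H)
  have *: "\<bar>G b - G a\<bar> \<le> b - a" if "a < b" for a b
  proof -
    obtain u where "G b - G a = (b - a) * (h u - u)"
      using MVT2[OF \<open>a < b\<close>, of G "\<lambda>t. h t - t"] G by blast
    then show ?thesis
      using mult_left_mono[OF close_id[of u], of "b - a"] that by (simp add: abs_mult)
  qed
  have "\<bar>G (x + y) - G x\<bar> \<le> \<bar>y\<bar>"
    using *[of x "x + y"] *[of "x + y" x] False unfolding y_def[symmetric]
    by (cases "y > 0") (auto simp: abs_minus_commute)
  moreover have "G (x + y) - G x = (avg z - (x + y / 2)) * y"
    using False by (simp add: G_def avg_def x_def y_def field_simps power2_eq_square)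
  ultimately have "\<bar>avg z - (x + y / 2)\<bar> * \<bar>y\<bar> \<le> 1 * \<bar>y\<bar>"
    by (simp add: abs_mult)
  then show ?thesis
    using False unfolding x_def y_def by (subst (asm) mult_le_cancel_right) auto
qed

text \<open>The extension stays within distance 2 of the linear map that halves the imaginary part.
  The estimate expresses properness.\<close>

lemma norm_extension_ge: "norm (extension z) \<ge> norm z / 2 - 2"
proof -
  define a b where "a = avg z - (Re z + Im z / 2)" and "b = avg (cnj z) - (Re z - Im z / 2)"
  have ab: "\<bar>a\<bar> \<le> 1" "\<bar>b\<bar> \<le> 1"
    using abs_avg_minus_linear_le[of z] abs_avg_minus_linear_le[of "cnj z"] by (simp_all add: a_def b_def)
  have eq: "extension z = Complex (Re z) (Im z / 2) + Complex ((a + b) / 2) ((a - b) / 2)"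
    by (simp add: extension_eq complex_eq_iff a_def b_def field_simps)
  have "norm (Complex ((a + b) / 2) ((a - b) / 2)) \<le> \<bar>(a + b) / 2\<bar> + \<bar>(a - b) / 2\<bar>"
    using cmod_le[of "Complex ((a + b) / 2) ((a - b) / 2)"] by simp
  also have "\<dots> \<le> 1 + 1"
    using ab abs_triangle_ineq[of a b] abs_triangle_ineq4[of a b] by (intro add_mono) simp_all
  finally have 1: "norm (Complex ((a + b) / 2) ((a - b) / 2)) \<le> 2" by simp
  have "z = Complex (Re z) (Im z / 2) + Complex 0 (Im z / 2)" by (simp add: complex_eq_iff)
  moreover have "norm (Complex 0 (Im z / 2)) \<le> norm z / 2"
    using abs_Im_le_cmod[of z] by (simp add: cmod_def)
  ultimately have 2: "norm (Complex (Re z) (Im z / 2)) \<ge> norm z / 2"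
    by (smt (verit) norm_triangle_ineq field_sum_of_halves)
  show ?thesis
    using 1 2 norm_diff_ineq[of "Complex (Re z) (Im z / 2)" "Complex ((a + b) / 2) ((a - b) / 2)"]
    unfolding eq by linarith
qed

text \<open>The range is open by invariance of domain and closed by properness, and the plane is
  connected.\<close>

lemma surj_extension: "surj extension"
proof -
  have "closure (range extension) \<subseteq> range extension"
  proof
    fix y assume y: "y \<in> closure (range extension)"
    define R where "R = 2 * (norm y + 3)"
    have sub: "range extension \<inter> ball y 1 \<subseteq> extension ` cball 0 R"
    proof clarify
      fix z assume "extension z \<in> ball y 1"
      then have "norm (extension z) \<le> norm y + 1"
        using norm_triangle_ineq2[of "extension z" y] by (simp add: dist_norm norm_minus_commute)
      then have "z \<in> cball 0 R"
        using norm_extension_ge[of z] by (simp add: R_def)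
      then show "extension z \<in> extension ` cball 0 R" by blast
    qed
    have "compact (extension ` cball 0 R)"
      by (intro compact_continuous_image continuous_on_subset[OF continuous_extension]) auto
    then have "closed (extension ` cball 0 R)" by (rule compact_imp_closed)
    moreover have "y \<in> closure (range extension \<inter> ball y 1)"
      using y open_Int_closure_subset[of "ball y 1" "range extension"] by (auto simp: Int_commute)
    ultimately show "y \<in> range extension"
      using sub closure_minimal by blast
  qed
  then have "closed (range extension)" by (simp add: closure_subset_eq)
  moreover have "open (range extension)"
    using invariance_of_domain[OF continuous_extension] inj_extension by simp
  ultimately show ?thesis
    using clopen[of "range extension"] by auto
qed

section \<open>Wirtinger derivatives and dilatation of the extension\<close>

definition ext_z :: "complex \<Rightarrow> complex" where
  "ext_z z = Complex ((avg_x z + avg_x (cnj z) + avg_y z + avg_y (cnj z)) / 4)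
     ((avg_x z - avg_x (cnj z) - avg_y z + avg_y (cnj z)) / 4)"

definition ext_zbar :: "complex \<Rightarrow> complex" where
  "ext_zbar z = Complex ((avg_x z + avg_x (cnj z) - avg_y z - avg_y (cnj z)) / 4)
     ((avg_x z - avg_x (cnj z) + avg_y z - avg_y (cnj z)) / 4)"

lemma has_derivative_extension:
  assumes "Im z \<noteq> 0"
  shows "(extension has_derivative (\<lambda>\<zeta>. ext_z z * \<zeta> + ext_zbar z * cnj \<zeta>)) (at z)"
proof -
  have 1: "((\<lambda>w. complex_of_real (avg w)) has_derivative
      (\<lambda>\<zeta>. of_real (avg_x z * Re \<zeta> + avg_y z * Im \<zeta>))) (at z)"
    using assms by (intro has_derivative_of_real has_derivative_avg)
  have "((\<lambda>w. avg (cnj w)) has_derivative (\<lambda>\<zeta>. avg_x (cnj z) * Re (cnj \<zeta>) + avg_y (cnj z) * Im (cnj \<zeta>))) (at z)"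
    by (rule has_derivative_compose[OF bounded_linear_imp_has_derivative[OF bounded_linear_cnj] has_derivative_avg])
       (use assms in simp)
  then have 2: "((\<lambda>w. complex_of_real (avg (cnj w))) has_derivative
      (\<lambda>\<zeta>. of_real (avg_x (cnj z) * Re (cnj \<zeta>) + avg_y (cnj z) * Im (cnj \<zeta>)))) (at z)"
    by (rule has_derivative_of_real)
  have "(extension has_derivative (\<lambda>\<zeta>. (1 + \<i>) / 2 * of_real (avg_x z * Re \<zeta> + avg_y z * Im \<zeta>) +
      (1 - \<i>) / 2 * of_real (avg_x (cnj z) * Re (cnj \<zeta>) + avg_y (cnj z) * Im (cnj \<zeta>)))) (at z)"
    unfolding extension_def by (intro has_derivative_add has_derivative_mult_right 1 2)
  then show ?thesis
    by (rule has_derivative_eq_rhs)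
       (simp add: fun_eq_iff complex_eq_iff ext_z_def ext_zbar_def field_simps)
qed

text \<open>The Jacobian \<open>(P * S + Q * R) / 2\<close> is a sum of products of positive terms
  without cancellation, and quasisymmetry makes all four partial derivatives comparable. It is
  therefore at least a fixed fraction of \<open>(norm (ext_z z))\<^sup>2\<close>.\<close>

lemma norm_ext_zbar_le:
  obtains k where "0 \<le> k" "k < 1" "\<forall>z. Im z \<noteq> 0 \<longrightarrow> norm (ext_zbar z) \<le> k * norm (ext_z z)"
proof -
  \<comment> \<open>The quotient of the lower bound \<open>P\<^sup>2 / (2 * M * (1 + M))\<close> for
    the Jacobian by the upper bound \<open>(1 + M)\<^sup>2 * P\<^sup>2 / 2\<close> for
    \<open>(norm (ext_z z))\<^sup>2\<close>.\<close>
  define \<kappa> where "\<kappa> = 1 / (M * (1 + M) ^ 3)"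
  have "1 \<le> M * (1 + M) ^ 3"
    using mult_mono[of 1 M 1 "(1 + M) ^ 3"] M_ge_1 one_le_power[of "1 + M" 3] by simp
  then have \<kappa>: "0 < \<kappa>" "\<kappa> \<le> 1" by (auto simp: \<kappa>_def)
  have sq: "(norm (ext_zbar z))\<^sup>2 \<le> (1 - \<kappa>) * (norm (ext_z z))\<^sup>2" if z: "Im z \<noteq> 0" for z
  proof -
    define P Q R S where "P = avg_x z" and "Q = avg_y z" and "R = avg_x (cnj z)" and "S = avg_y (cnj z)"
    have pos: "P > 0" "Q > 0" "R > 0" "S > 0"
      using z by (auto simp: P_def Q_def R_def S_def intro!: avg_x_pos avg_y_pos)
    have PR: "P \<le> M * R" "R \<le> M * P" "Q \<le> P" "S \<le> R" "P / (2 * (1 + M)) \<le> Q" "R / (2 * (1 + M)) \<le> S"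
      using avg_x_cnj_le[of z] avg_x_cnj_le[of "cnj z"] avg_y_le[of z] avg_y_le[of "cnj z"]
        avg_y_ge[of z] avg_y_ge[of "cnj z"] z by (simp_all add: P_def Q_def R_def S_def)
    have diff: "(norm (ext_z z))\<^sup>2 - (norm (ext_zbar z))\<^sup>2 = (P * S + Q * R) / 2"
      unfolding cmod_power2 ext_z_def ext_zbar_def P_def Q_def R_def S_def
      by (simp add: power2_eq_square field_simps)
    have "(norm (ext_z z))\<^sup>2 = ((P + R + Q + S)\<^sup>2 + (P - R - Q + S)\<^sup>2) / 16"
      unfolding cmod_power2 ext_z_def P_def Q_def R_def S_def
      by (simp add: power_divide)
    also have "(P - R - Q + S)\<^sup>2 \<le> (P + R + Q + S)\<^sup>2"
      using pos by (intro abs_le_square_iff[THEN iffD1]) auto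
    finally have "(norm (ext_z z))\<^sup>2 \<le> (P + R + Q + S)\<^sup>2 / 8" by simp
    also have "(P + R + Q + S)\<^sup>2 \<le> (2 * (1 + M) * P)\<^sup>2"
      using pos PR by (intro power_mono) (auto simp: algebra_simps)
    finally have "(norm (ext_z z))\<^sup>2 \<le> (1 + M)\<^sup>2 * P\<^sup>2 / 2"
      unfolding power_mult_distrib by (simp add: mult.commute)
    then have "\<kappa> * (norm (ext_z z))\<^sup>2 \<le> \<kappa> * ((1 + M)\<^sup>2 * P\<^sup>2 / 2)"
      using \<kappa> by (intro mult_left_mono) auto
    also have "\<dots> = P * (P / M) / (1 + M) / 2"
      using M_ge_1 by (simp add: \<kappa>_def power3_eq_cube power2_eq_square divide_simps)
    also have "\<dots> \<le> P * R / (1 + M) / 2"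
      using PR(1) pos M_ge_1 by (intro divide_right_mono mult_left_mono) (auto simp: field_simps)
    also have "P * R / (1 + M) = P * (R / (2 * (1 + M))) + P / (2 * (1 + M)) * R"
      using M_ge_1 by (simp add: divide_simps)
    also have "\<dots> \<le> P * S + Q * R"
      using PR pos by (intro add_mono mult_left_mono mult_right_mono) auto
    finally show ?thesis unfolding left_diff_distrib using diff by linarith
  qed
  have "norm (ext_zbar z) \<le> sqrt (1 - \<kappa>) * norm (ext_z z)" if "Im z \<noteq> 0" for z
    using real_sqrt_le_mono[OF sq[OF that]] by (simp add: real_sqrt_mult)
  then show thesis
    using \<kappa> by (intro that[of "sqrt (1 - \<kappa>)"]) auto
qed

end

section \<open>Absolute continuity of the extension along lines and circles\<close>

text \<open>The expression of the sphere map in any pair of charts is \<open>extension\<close> with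
  one of these before it and one after it.\<close>

definition coordinate_changes :: "(complex \<Rightarrow> complex) set" where
  "coordinate_changes = {\<lambda>w. w, \<lambda>w. 1 / w}"

lemma DERIV_one_over:
  fixes z :: complex
  assumes "z \<noteq> 0"
  shows "((\<lambda>w. 1 / w) has_field_derivative - 1 / z\<^sup>2) (at z)"
  using assms by (auto intro!: derivative_eq_intros simp: power2_eq_square)

context quasisymmetric_line_map
begin

lemma continuous_avg_xy:
  assumes "continuous_on S \<gamma>" "\<And>s. s \<in> S \<Longrightarrow> Im (\<gamma> s) \<noteq> 0"
  shows "continuous_on S (\<lambda>s. avg_x (\<gamma> s))" "continuous_on S (\<lambda>s. avg_y (\<gamma> s))"
  unfolding avg_x_def avg_y_def using assms
  by (auto intro!: continuous_intros continuous_on_compose2[OF cont] continuous_on_compose2[OF continuous_avg])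

lemma DERIV_avg_path:
  assumes "(\<gamma> has_vector_derivative \<gamma>') (at s)" "Im (\<gamma> s) \<noteq> 0"
  shows "((\<lambda>s. avg (\<gamma> s)) has_real_derivative avg_x (\<gamma> s) * Re \<gamma>' + avg_y (\<gamma> s) * Im \<gamma>') (at s)"
  unfolding has_field_derivative_def
  by (rule has_derivative_eq_rhs[OF has_derivative_compose[OF assms(1)[unfolded has_vector_derivative_def]
          has_derivative_avg[OF assms(2)]]])
     (simp add: fun_eq_iff algebra_simps)

lemma abs_continuous_avg_path:
  assumes \<gamma>: "\<And>s. (\<gamma> has_vector_derivative \<gamma>' s) (at s)" and \<gamma>': "continuous_on UNIV \<gamma>'"
    and Im: "\<And>s. Im (\<gamma> s) \<noteq> 0"
  shows "abs_continuous_on_interval a b (\<lambda>s. of_real (avg (\<gamma> s)))"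
proof (rule abs_continuous_C1)
  have "continuous_on UNIV \<gamma>"
    by (intro continuous_at_imp_continuous_on ballI has_vector_derivative_continuous[OF \<gamma>])
  then have "continuous_on UNIV (\<lambda>s. avg_x (\<gamma> s) * Re (\<gamma>' s) + avg_y (\<gamma> s) * Im (\<gamma>' s))"
    using \<gamma>' Im by (intro continuous_intros continuous_avg_xy)
  then show "continuous_on {a..b} (\<lambda>s. avg_x (\<gamma> s) * Re (\<gamma>' s) + avg_y (\<gamma> s) * Im (\<gamma>' s))"
    by (rule continuous_on_subset) simp
qed (use DERIV_avg_path[OF \<gamma> Im] in blast)

text \<open>A path that crosses the real axis at \<open>s = 0\<close>: since \<open>Re \<gamma>'\<close> is there of the order of
  \<open>Im \<gamma>\<close>, the horizontal part of the derivative is bounded, and the vertical part has the sign of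
  \<open>Im \<gamma>'\<close>. This replaces any estimate of the modulus of continuity of \<open>h\<close>.\<close>

lemma abs_continuous_avg_crossing:
  assumes \<gamma>: "\<And>s. (\<gamma> has_vector_derivative \<gamma>' s) (at s)" and \<gamma>': "continuous_on UNIV \<gamma>'"
    and Im: "\<And>s. s \<noteq> 0 \<Longrightarrow> Im (\<gamma> s) \<noteq> 0"
    and near: "r > 0" "\<And>s. \<bar>s\<bar> < r \<Longrightarrow> \<bar>Re (\<gamma>' s)\<bar> \<le> C * \<bar>Im (\<gamma> s)\<bar>" "\<And>s. \<bar>s\<bar> < r \<Longrightarrow> \<bar>Im (\<gamma> s)\<bar> \<le> B"
    and sign: "\<sigma> = 1 \<or> \<sigma> = -1" "\<And>s. \<bar>s\<bar> < r \<Longrightarrow> \<sigma> * Im (\<gamma>' s) \<ge> 0" and "C \<ge> 0" "B \<ge> 0"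
  shows "abs_continuous_on_interval a b (\<lambda>s. of_real (avg (\<gamma> s)))"
proof -
  \<comment> \<open>A symmetric interval containing \<open>{a..b}\<close> has the crossing parameter
    0 in its interior.\<close>
  define N where "N = \<bar>a\<bar> + \<bar>b\<bar> + 1"
  let ?f' = "\<lambda>s. \<sigma> * (avg_x (\<gamma> s) * Re (\<gamma>' s) + avg_y (\<gamma> s) * Im (\<gamma>' s))"
  have cont_\<gamma>: "continuous_on UNIV \<gamma>"
    by (intro continuous_at_imp_continuous_on ballI has_vector_derivative_continuous[OF \<gamma>])
  \<comment> \<open>Multiplication by \<sigma> makes the vertical term nonnegative for a downward
    crossing too.\<close>
  have "abs_continuous_on_interval (- N) N (\<lambda>s. of_real (\<sigma> * avg (\<gamma> s)))"
  proof (rule abs_continuous_C1_off_point[where p = 0 and f' = ?f' and C = "C * (B + 2)" and r = r])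
    show "continuous_on UNIV (\<lambda>s. \<sigma> * avg (\<gamma> s))"
      by (intro continuous_intros continuous_on_compose2[OF continuous_avg] cont_\<gamma>) auto
    have "continuous_on (- {0}) ?f'"
      using Im by (intro continuous_intros continuous_avg_xy continuous_on_subset[OF \<gamma>']
          continuous_on_subset[OF cont_\<gamma>]) auto
    then show "continuous_on ({- N..N} - {0}) ?f'"
      by (rule continuous_on_subset) auto
    show "((\<lambda>s. \<sigma> * avg (\<gamma> s)) has_real_derivative ?f' s) (at s)" if "s \<noteq> 0" for s
      using DERIV_cmult[OF DERIV_avg_path[OF \<gamma> Im[OF that]]] by simp
    show "?f' s \<ge> - (C * (B + 2))" if s: "s \<noteq> 0" "\<bar>s - 0\<bar> < r" for s
    proof -
      define x y where "x = Re (\<gamma> s)" and "y = Im (\<gamma> s)"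
      have y: "y \<noteq> 0" "\<bar>y\<bar> \<le> B" "\<bar>Re (\<gamma>' s)\<bar> \<le> C * \<bar>y\<bar>"
        using s Im near(2,3)[of s] by (auto simp: y_def)
      have "\<bar>avg_x (\<gamma> s) * Re (\<gamma>' s)\<bar> \<le> \<bar>avg_x (\<gamma> s)\<bar> * (C * \<bar>y\<bar>)"
        unfolding abs_mult using y by (intro mult_left_mono) auto
      \<comment> \<open>The denominator \<open>y\<close> of \<open>avg_x\<close> cancels against the
        bound on \<open>Re (\<gamma>' s)\<close>, leaving an increment of \<open>h\<close>, which is
        at most \<open>\<bar>y\<bar> + 2\<close>.\<close>
      also have "\<dots> = C * \<bar>h (x + y) - h x\<bar>"
        using y by (simp add: avg_x_def x_def y_def abs_divide)
      also have "\<dots> \<le> C * (B + 2)"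
        using close_id[of "x + y"] close_id[of x] y(2) \<open>C \<ge> 0\<close>
        by (intro mult_left_mono) linarith+
      finally have "\<bar>\<sigma> * (avg_x (\<gamma> s) * Re (\<gamma>' s))\<bar> \<le> C * (B + 2)"
        using sign(1) by auto
      moreover have "0 \<le> avg_y (\<gamma> s) * (\<sigma> * Im (\<gamma>' s))"
        using sign(2)[of s] s avg_y_pos[OF Im[of s]] by simp
      ultimately show ?thesis
        unfolding distrib_left by (simp add: mult.left_commute abs_le_iff)
    qed
  qed (use near \<open>C \<ge> 0\<close> \<open>B \<ge> 0\<close> in \<open>auto simp: N_def\<close>)
  then have "abs_continuous_on_interval (- N) N (\<lambda>s. of_real \<sigma> * of_real (\<sigma> * avg (\<gamma> s)))"
    by (rule abs_continuous_cmult)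
  then have "abs_continuous_on_interval (- N) N (\<lambda>s. of_real (avg (\<gamma> s)))"
    by (rule abs_continuous_cong) (use sign(1) in auto)
  then show ?thesis
    by (rule abs_continuous_subinterval) (auto simp: N_def)
qed

lemma abs_continuous_extension_path:
  assumes "abs_continuous_on_interval a b (\<lambda>s. of_real (avg (\<gamma> s)))"
    "abs_continuous_on_interval a b (\<lambda>s. of_real (avg (cnj (\<gamma> s))))"
  shows "abs_continuous_on_interval a b (\<lambda>s. extension (\<gamma> s))"
  unfolding extension_def by (intro abs_continuous_add abs_continuous_cmult assms)

lemma abs_continuous_extension_noncrossing:
  assumes \<gamma>: "\<And>s. (\<gamma> has_vector_derivative \<gamma>' s) (at s)" and \<gamma>': "continuous_on UNIV \<gamma>'"
    and Im: "\<And>s. Im (\<gamma> s) \<noteq> 0"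
  shows "abs_continuous_on_interval a b (\<lambda>s. extension (\<gamma> s))"
proof (rule abs_continuous_extension_path)
  show "abs_continuous_on_interval a b (\<lambda>s. of_real (avg (cnj (\<gamma> s))))"
    by (rule abs_continuous_avg_path[where \<gamma>' = "\<lambda>s. cnj (\<gamma>' s)"])
       (use Im in \<open>auto intro!: has_vector_derivative_cnj \<gamma> continuous_intros \<gamma>'\<close>)
qed (rule abs_continuous_avg_path[OF assms])

lemma abs_continuous_extension_crossing:
  assumes \<gamma>: "\<And>s. (\<gamma> has_vector_derivative \<gamma>' s) (at s)" and \<gamma>': "continuous_on UNIV \<gamma>'"
    and Im: "\<And>s. s \<noteq> 0 \<Longrightarrow> Im (\<gamma> s) \<noteq> 0"
    and near: "r > 0" "\<And>s. \<bar>s\<bar> < r \<Longrightarrow> \<bar>Re (\<gamma>' s)\<bar> \<le> C * \<bar>Im (\<gamma> s)\<bar>" "\<And>s. \<bar>s\<bar> < r \<Longrightarrow> \<bar>Im (\<gamma> s)\<bar> \<le> B"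
    and sign: "\<sigma> = 1 \<or> \<sigma> = -1" "\<And>s. \<bar>s\<bar> < r \<Longrightarrow> \<sigma> * Im (\<gamma>' s) \<ge> 0" and "C \<ge> 0" "B \<ge> 0"
  shows "abs_continuous_on_interval a b (\<lambda>s. extension (\<gamma> s))"
proof (rule abs_continuous_extension_path)
  show "abs_continuous_on_interval a b (\<lambda>s. of_real (avg (cnj (\<gamma> s))))"
    \<comment> \<open>The conjugate path crosses in the opposite direction, hence
      \<open>- \<sigma>\<close>.\<close>
    by (rule abs_continuous_avg_crossing[where \<gamma>' = "\<lambda>s. cnj (\<gamma>' s)" and \<sigma> = "- \<sigma>" and r = r and C = C and B = B])
       (use assms in \<open>auto intro!: has_vector_derivative_cnj continuous_intros\<close>)
qed (rule abs_continuous_avg_crossing[OF assms])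

text \<open>Under \<open>1 / w\<close> the line becomes a circle touching the real axis at 0,
  without that point, so neither coordinate gives a crossing.\<close>

lemma abs_continuous_extension_horizontal:
  assumes "\<phi> \<in> coordinate_changes" "y \<noteq> 0"
  shows "abs_continuous_on_interval a b (\<lambda>s. extension (\<phi> (Complex s y)))"
proof -
  have nz: "Complex s y \<noteq> 0" for s using assms(2) by (simp add: complex_eq_iff)
  have line: "((\<lambda>s. Complex s y) has_vector_derivative 1) (at s)" for s
    unfolding Complex_eq by (auto intro!: derivative_eq_intros)
  have cline: "continuous_on UNIV (\<lambda>s. Complex s y)"
    unfolding Complex_eq by (intro continuous_intros)
  consider "\<phi> = (\<lambda>w. w)" | "\<phi> = (\<lambda>w. 1 / w)"
    using assms(1) by (auto simp: coordinate_changes_def)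
  then show ?thesis
  proof cases
    case 1
    then show ?thesis
      unfolding 1 using assms(2) line by (intro abs_continuous_extension_noncrossing[where \<gamma>' = "\<lambda>_. 1"]) auto
  next
    case 2
    show ?thesis
      unfolding 2
    proof (rule abs_continuous_extension_noncrossing[where \<gamma>' = "\<lambda>s. - 1 / (Complex s y)\<^sup>2"])
      show "((\<lambda>s. 1 / Complex s y) has_vector_derivative - 1 / (Complex s y)\<^sup>2) (at s)" for s
        using field_vector_diff_chain_at[OF line DERIV_one_over[OF nz]] by (simp add: o_def)
      show "continuous_on UNIV (\<lambda>s. - 1 / (Complex s y)\<^sup>2)"
        using nz by (intro continuous_intros cline) auto
      show "Im (1 / Complex s y) \<noteq> 0" for s
        using assms(2) nz[of s] by (simp add: Im_divide complex_eq_iff sum_power2_eq_zero_iff)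
    qed
  qed
qed

text \<open>Under \<open>1 / w\<close> the line becomes the circle with diameter from 0 to
  \<open>1 / x\<close>, without 0. It meets the axis only at \<open>1 / x\<close>, at a right angle,
  so the horizontal velocity vanishes there as the crossing lemma demands.\<close>

lemma abs_continuous_extension_vertical:
  assumes "\<phi> \<in> coordinate_changes" "x \<noteq> 0"
  shows "abs_continuous_on_interval a b (\<lambda>s. extension (\<phi> (Complex x s)))"
proof -
  have nz: "Complex x s \<noteq> 0" for s using assms(2) by (simp add: complex_eq_iff)
  have line: "((\<lambda>s. Complex x s) has_vector_derivative \<i>) (at s)" for s
    unfolding Complex_eq by (auto intro!: derivative_eq_intros)
  have cline: "continuous_on UNIV (\<lambda>s. Complex x s)"
    unfolding Complex_eq by (intro continuous_intros)
  consider "\<phi> = (\<lambda>w. w)" | "\<phi> = (\<lambda>w. 1 / w)"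
    using assms(1) by (auto simp: coordinate_changes_def)
  then show ?thesis
  proof cases
    case 1
    show ?thesis
      unfolding 1 using line
      by (intro abs_continuous_extension_crossing[where \<gamma>' = "\<lambda>_. \<i>" and r = 1 and C = 0 and B = 1 and \<sigma> = 1]) auto
  next
    case 2
    define n where "n s = x\<^sup>2 + s\<^sup>2" for s
    have n: "n s > 0" "x\<^sup>2 \<le> n s" for s using assms(2) by (auto simp: n_def sum_power2_gt_zero_iff)
    have \<gamma>: "1 / Complex x s = Complex (x / n s) (- s / n s)" for s
      by (simp add: complex_eq_iff Re_divide Im_divide n_def)
    have \<gamma>': "- \<i> / (Complex x s)\<^sup>2 = Complex (- 2 * x * s / (n s)\<^sup>2) (- (x\<^sup>2 - s\<^sup>2) / (n s)\<^sup>2)" for s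
    proof -
      have "- \<i> / (Complex x s)\<^sup>2 = - \<i> * (1 / Complex x s)\<^sup>2" by (simp add: power_divide)
      then show ?thesis
        unfolding \<gamma> by (simp add: complex_eq_iff power2_eq_square diff_divide_distrib mult_ac)
    qed
    show ?thesis
      unfolding 2
    \<comment> \<open>The circle reaches its highest and lowest points at \<open>s = x\<close> and
      \<open>s = - x\<close>, and between them it descends, whence \<open>r\<close> and \<sigma>.
      \<open>C\<close> comes from \<open>\<bar>Re \<gamma>'\<bar> = 2 * \<bar>x\<bar> / n s *
      \<bar>Im \<gamma>\<bar>\<close> and \<open>n s \<ge> x\<^sup>2\<close>; \<open>B\<close> from
      \<open>\<bar>s\<bar> * \<bar>x\<bar> \<le> n s\<close>.\<close>
    proof (rule abs_continuous_extension_crossing[where \<gamma>' = "\<lambda>s. - \<i> / (Complex x s)\<^sup>2" and r = "\<bar>x\<bar>"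
          and C = "2 / \<bar>x\<bar>" and B = "1 / \<bar>x\<bar>" and \<sigma> = "-1"])
      show "((\<lambda>s. 1 / Complex x s) has_vector_derivative - \<i> / (Complex x s)\<^sup>2) (at s)" for s
        using field_vector_diff_chain_at[OF line DERIV_one_over[OF nz]] by (simp add: o_def)
      show "continuous_on UNIV (\<lambda>s. - \<i> / (Complex x s)\<^sup>2)"
        using nz by (intro continuous_intros cline) auto
      show "Im (1 / Complex x s) \<noteq> 0" if "s \<noteq> 0" for s
        using that n(1)[of s] by (simp add: \<gamma>)
      show "\<bar>Re (- \<i> / (Complex x s)\<^sup>2)\<bar> \<le> 2 / \<bar>x\<bar> * \<bar>Im (1 / Complex x s)\<bar>" for s
      proof -
        have "\<bar>Re (- \<i> / (Complex x s)\<^sup>2)\<bar> = 2 * \<bar>x\<bar> / n s * (\<bar>s\<bar> / n s)"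
          using n(1)[of s] unfolding \<gamma>' by (simp add: abs_mult power2_eq_square)
        also have "\<dots> \<le> 2 / \<bar>x\<bar> * (\<bar>s\<bar> / n s)"
        proof (rule mult_right_mono)
          have "\<bar>x\<bar> * \<bar>x\<bar> \<le> n s" using n(2)[of s] by (simp add: power2_eq_square)
          then show "2 * \<bar>x\<bar> / n s \<le> 2 / \<bar>x\<bar>"
            using assms(2) n(1)[of s] by (simp add: divide_simps)
        qed (use n(1)[of s] in auto)
        finally show ?thesis using n(1)[of s] by (simp add: \<gamma>)
      qed
      show "\<bar>Im (1 / Complex x s)\<bar> \<le> 1 / \<bar>x\<bar>" if "\<bar>s\<bar> < \<bar>x\<bar>" for s
      proof -
        have "\<bar>s\<bar> * \<bar>x\<bar> \<le> \<bar>x\<bar> * \<bar>x\<bar>" using that by (intro mult_right_mono) auto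
        then have "\<bar>s\<bar> * \<bar>x\<bar> \<le> n s" using n(2)[of s] by (simp add: power2_eq_square)
        then show ?thesis using n(1)[of s] assms(2) by (simp add: \<gamma> divide_simps)
      qed
      show "0 \<le> -1 * Im (- \<i> / (Complex x s)\<^sup>2)" if "\<bar>s\<bar> < \<bar>x\<bar>" for s
        using that n(1)[of s] unfolding \<gamma>' by (simp add: abs_le_square_iff[symmetric])
    qed (use assms(2) in auto)
  qed
qed

end

section \<open>Quasiconformality in the charts of the sphere\<close>

lemma AE_Im_nonzero: "AE z in lborel. Im z \<noteq> 0"
proof -
  have eq: "{z. Im z = 0} = {z. \<i> \<bullet> z = 0}" by (simp add: inner_complex_def)
  have "negligible {z. Im z = 0}"
    unfolding eq by (rule negligible_hyperplane) simp
  then have "{z. Im z = 0} \<in> null_sets lebesgue"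
    by (simp add: negligible_iff_null_sets)
  moreover have "closed {z. Im z = 0}"
    by (intro closed_Collect_eq continuous_intros)
  ultimately have "{z. Im z = 0} \<in> null_sets lborel"
    by (simp add: null_sets_completion_iff)
  then show ?thesis
    using AE_not_in by force
qed

text \<open>With these partial derivatives \<open>p\<close> and \<open>q\<close>, the combinations
  in the definition of quasiconformality are \<open>(p - \<i> * q) / 2 = a\<close> and
  \<open>(p + \<i> * q) / 2 = b\<close>.\<close>

lemma partials_of_has_derivative:
  assumes "(f has_derivative (\<lambda>\<zeta>. a * \<zeta> + b * cnj \<zeta>)) (at z)"
  shows "((\<lambda>x. f (Complex x (Im z))) has_vector_derivative a + b) (at (Re z))"
    "((\<lambda>y. f (Complex (Re z) y)) has_vector_derivative \<i> * (a - b)) (at (Im z))"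
proof -
  have f: "(f has_derivative (\<lambda>\<zeta>. a * \<zeta> + b * cnj \<zeta>)) (at (Complex (Re z) (Im z)))"
    using assms by simp
  have 1: "((\<lambda>x. Complex x (Im z)) has_derivative of_real) (at (Re z))"
    unfolding Complex_eq by (auto intro!: derivative_eq_intros)
  have 2: "((\<lambda>y. Complex (Re z) y) has_derivative (\<lambda>s. \<i> * of_real s)) (at (Im z))"
    unfolding Complex_eq by (auto intro!: derivative_eq_intros)
  show "((\<lambda>x. f (Complex x (Im z))) has_vector_derivative a + b) (at (Re z))"
    unfolding has_vector_derivative_def
    by (rule has_derivative_eq_rhs[OF has_derivative_compose[OF 1 f]])
       (simp add: fun_eq_iff scaleR_conv_of_real algebra_simps)
  show "((\<lambda>y. f (Complex (Re z) y)) has_vector_derivative \<i> * (a - b)) (at (Im z))"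
    unfolding has_vector_derivative_def
    by (rule has_derivative_eq_rhs[OF has_derivative_compose[OF 2 f]])
       (simp add: fun_eq_iff scaleR_conv_of_real algebra_simps)
qed

lemma coordinate_change_has_derivative:
  assumes "\<phi> \<in> coordinate_changes" "z \<noteq> 0 \<or> \<phi> = (\<lambda>w. w)"
  obtains d where "(\<phi> has_derivative (*) d) (at z)"
proof -
  consider "\<phi> = (\<lambda>w. w)" | "\<phi> = (\<lambda>w. 1 / w)" "z \<noteq> 0"
    using assms unfolding coordinate_changes_def by blast
  then have "\<exists>d. (\<phi> has_field_derivative d) (at z)"
    using DERIV_ident[of "at z"] DERIV_one_over[of z] by cases blast+
  then show thesis
    using that by (auto simp: has_field_derivative_def)
qed

lemma Im_coordinate_change: "\<phi> \<in> coordinate_changes \<Longrightarrow> Im z \<noteq> 0 \<Longrightarrow> Im (\<phi> z) \<noteq> 0"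
  by (auto simp: coordinate_changes_def Im_divide sum_power2_eq_zero_iff)

context quasisymmetric_line_map
begin

text \<open>One statement for all four pairs of charts. The formula for \<open>f\<close> is demanded
  only off 0, where \<open>1 / w\<close> is holomorphic; the lines through 0 parallel to the axes
  are among the exceptional ones. The constant solves \<open>(K - 1) / (K + 1) = k\<close>.\<close>

lemma quasiconformal_on_chart:
  assumes k: "0 \<le> k" "k < 1" "\<forall>z. Im z \<noteq> 0 \<longrightarrow> norm (ext_zbar z) \<le> k * norm (ext_z z)"
    and U: "open U" "continuous_on U f" "inj_on f U"
    and \<phi>: "\<phi> \<in> coordinate_changes" and \<psi>: "\<psi> \<in> coordinate_changes"
    and f: "\<And>z. z \<in> U \<Longrightarrow> z \<noteq> 0 \<Longrightarrow> f z = \<psi> (extension (\<phi> z))"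
    and nonzero: "\<And>z. z \<in> U \<Longrightarrow> z \<noteq> 0 \<Longrightarrow> extension (\<phi> z) \<noteq> 0 \<or> \<psi> = (\<lambda>w. w)"
  shows "quasiconformal_on ((1 + k) / (1 - k)) U f"
  unfolding quasiconformal_on_def
proof (intro conjI)
  show "(1 + k) / (1 - k) \<ge> 1" using k by simp
  have "\<exists>g. homeomorphism U (f ` U) f g"
    using invariance_of_domain_homeomorphism[OF U(1,2) _ U(3)] by auto
  then show "\<exists>g. homeomorphism U (f ` U) f g" .
  have path: "abs_continuous_on_interval a b (\<lambda>s. f (\<gamma> s))"
    if \<gamma>: "\<And>s. s \<in> {a..b} \<Longrightarrow> \<gamma> s \<in> U \<and> \<gamma> s \<noteq> 0" "continuous_on {a..b} \<gamma>"
      and ac: "abs_continuous_on_interval a b (\<lambda>s. extension (\<phi> (\<gamma> s)))" for \<gamma> a b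
  proof -
    consider "\<psi> = (\<lambda>w. w)" | "\<psi> = (\<lambda>w. 1 / w)" "\<psi> \<noteq> (\<lambda>w. w)"
      using \<psi> by (auto simp: coordinate_changes_def)
    then have "abs_continuous_on_interval a b (\<lambda>s. \<psi> (extension (\<phi> (\<gamma> s))))"
    proof cases
      case 1
      then show ?thesis using ac by simp
    next
      case 2
      have "continuous_on {a..b} (\<lambda>s. \<phi> (\<gamma> s))"
        using \<phi> \<gamma> by (auto simp: coordinate_changes_def intro!: continuous_intros)
      then have "continuous_on {a..b} (\<lambda>s. extension (\<phi> (\<gamma> s)))"
        by (rule continuous_on_compose2[OF continuous_extension]) simp
      moreover have "extension (\<phi> (\<gamma> s)) \<noteq> 0" if "s \<in> {a..b}" for s
        using nonzero[of "\<gamma> s"] \<gamma>(1)[OF that] 2 by blast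
      ultimately show ?thesis
        unfolding 2(1) by (rule abs_continuous_inverse[OF ac])
    qed
    then show ?thesis
      by (rule abs_continuous_cong) (use \<gamma>(1) f in auto)
  qed
  show "ACL_on U f"
    unfolding ACL_on_def
  proof (intro allI impI conjI)
    fix a b c d assume box: "cbox (Complex a c) (Complex b d) \<subseteq> U"
    have mem: "Complex x y \<in> U" if "a \<le> x" "x \<le> b" "c \<le> y" "y \<le> d" for x y
      using box that by (force simp: in_cbox_complex_iff)
    have line: "continuous_on A (\<lambda>s. Complex s t)" "continuous_on A (\<lambda>s. Complex t s)" for A t
      unfolding Complex_eq by (intro continuous_intros)+
    have "abs_continuous_on_interval a b (\<lambda>x. f (Complex x y))" if "y \<in> {c..d}" "y \<noteq> 0" for y
      using that mem by (intro path abs_continuous_extension_horizontal \<phi> line) (auto simp: complex_eq_iff)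
    then show "AE y in lborel. y \<in> {c..d} \<longrightarrow> abs_continuous_on_interval a b (\<lambda>x. f (Complex x y))"
      using AE_lborel_singleton[of "0 :: real"] by (auto elim!: eventually_mono)
    have "abs_continuous_on_interval c d (\<lambda>y. f (Complex x y))" if "x \<in> {a..b}" "x \<noteq> 0" for x
      using that mem by (intro path abs_continuous_extension_vertical \<phi> line) (auto simp: complex_eq_iff)
    then show "AE x in lborel. x \<in> {a..b} \<longrightarrow> abs_continuous_on_interval c d (\<lambda>y. f (Complex x y))"
      using AE_lborel_singleton[of "0 :: real"] by (auto elim!: eventually_mono)
  qed
  have "\<exists>p q. ((\<lambda>x. f (Complex x (Im z))) has_vector_derivative p) (at (Re z)) \<and>
      ((\<lambda>y. f (Complex (Re z) y)) has_vector_derivative q) (at (Im z)) \<and>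
      cmod ((p + \<i> * q) / 2) \<le> ((1 + k) / (1 - k) - 1) / ((1 + k) / (1 - k) + 1) * cmod ((p - \<i> * q) / 2)"
    if z: "Im z \<noteq> 0" "z \<in> U" for z
  proof -
    have z0: "z \<noteq> 0" using z by auto
    obtain d where d: "(\<phi> has_derivative (*) d) (at z)"
      using coordinate_change_has_derivative[OF \<phi>, of z] z0 by blast
    obtain c where c: "(\<psi> has_derivative (*) c) (at (extension (\<phi> z)))"
      using coordinate_change_has_derivative[OF \<psi>] nonzero[OF z(2) z0] by blast
    \<comment> \<open>The chain rule with holomorphic maps on both sides: the inner factor is
      conjugated in the antilinear part only, so both moduli are multiplied by
      \<open>norm c * norm d\<close> and their ratio is unchanged.\<close>
    define a b where "a = c * ext_z (\<phi> z) * d" and "b = c * ext_zbar (\<phi> z) * cnj d"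
    have Im: "Im (\<phi> z) \<noteq> 0" using \<phi> z(1) by (rule Im_coordinate_change)
    have "((\<lambda>z. \<psi> (extension (\<phi> z))) has_derivative (\<lambda>\<zeta>. a * \<zeta> + b * cnj \<zeta>)) (at z)"
      by (rule has_derivative_eq_rhs[OF has_derivative_compose[OF
            has_derivative_compose[OF d has_derivative_extension[OF Im]] c]])
         (simp add: fun_eq_iff a_def b_def algebra_simps)
    then have "(f has_derivative (\<lambda>\<zeta>. a * \<zeta> + b * cnj \<zeta>)) (at z)"
      by (rule has_derivative_transform_within_open[where s = "U - {0}"]) (use U z z0 f in auto)
    note partials = partials_of_has_derivative[OF this]
    have "norm (ext_zbar (\<phi> z)) * (norm c * norm d) \<le> k * norm (ext_z (\<phi> z)) * (norm c * norm d)"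
      by (intro mult_right_mono k(3)[rule_format] Im) simp
    then have "norm b \<le> k * norm a"
      by (simp add: a_def b_def norm_mult mult_ac)
    moreover have "((1 + k) / (1 - k) - 1) / ((1 + k) / (1 - k) + 1) = k"
      using k by (simp add: field_simps)
    moreover have "((a + b) + \<i> * (\<i> * (a - b))) / 2 = b" "((a + b) - \<i> * (\<i> * (a - b))) / 2 = a"
      by (simp_all add: algebra_simps)
    ultimately have "cmod (((a + b) + \<i> * (\<i> * (a - b))) / 2)
        \<le> ((1 + k) / (1 - k) - 1) / ((1 + k) / (1 - k) + 1) * cmod (((a + b) - \<i> * (\<i> * (a - b))) / 2)"
      by simp
    with partials show ?thesis by blast
  qed
  then show "AE z in lborel. z \<in> U \<longrightarrow>
        (\<exists>p q. ((\<lambda>x. f (Complex x (Im z))) has_vector_derivative p) (at (Re z)) \<and>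
               ((\<lambda>y. f (Complex (Re z) y)) has_vector_derivative q) (at (Im z)) \<and>
               cmod ((p + \<i> * q) / 2) \<le> ((1 + k) / (1 - k) - 1) / ((1 + k) / (1 - k) + 1) * cmod ((p - \<i> * q) / 2))"
    using AE_Im_nonzero by (auto elim!: eventually_mono)
qed (rule U(1))

end

section \<open>The topology and the charts of the sphere\<close>

lemma continuous_map_riemann_sphere:
  assumes "homeomorphism UNIV UNIV F G"
  shows "continuous_map riemann_sphere riemann_sphere (map_option F)"
proof -
  have F: "continuous_on UNIV F" and G: "continuous_on UNIV G" "\<And>x. G (F x) = x" "\<And>y. F (G y) = y"
    using assms by (auto simp: homeomorphism_def)
  have "openin riemann_sphere (map_option F -` V)" if "openin riemann_sphere V" for V
    using that unfolding riemann_sphere_def openin_Alexandroff_compactification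
  proof (elim disjE exE conjE)
    fix W :: "complex set" assume W: "openin euclidean W" and V: "V = Some ` W"
    have "map_option F -` V = Some ` (F -` W)"
      using V by (auto simp: image_iff)
    moreover have "openin euclidean (F -` W)"
      using F W by (simp add: open_vimage)
    ultimately show "(\<exists>U. openin euclidean U \<and> map_option F -` V = Some ` U) \<or>
        (\<exists>C. compactin euclidean C \<and> closedin euclidean C \<and>
          map_option F -` V = insert None (Some ` (topspace euclidean - C)))"
      by blast
  next
    fix C :: "complex set" assume C: "compactin euclidean C"
      and V: "V = insert None (Some ` (topspace euclidean - C))"
    \<comment> \<open>Neighbourhoods of infinity pull back to such because the preimage of a compact
      set is its image under the continuous inverse.\<close>
    have "F -` C = G ` C"
      using G by (auto simp: image_iff) metis
    moreover have "compact (G ` C)"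
      using C G(1) by (auto intro!: compact_continuous_image intro: continuous_on_subset)
    ultimately have "compactin euclidean (F -` C)" "closedin euclidean (F -` C)"
      by (simp_all add: compact_imp_closed)
    moreover have "map_option F -` V = insert None (Some ` (topspace euclidean - F -` C))"
    proof (rule set_eqI)
      show "x \<in> map_option F -` V \<longleftrightarrow> x \<in> insert None (Some ` (topspace euclidean - F -` C))" for x
        by (cases x) (auto simp: V)
    qed
    ultimately show "(\<exists>U. openin euclidean U \<and> map_option F -` V = Some ` U) \<or>
        (\<exists>C. compactin euclidean C \<and> closedin euclidean C \<and>
          map_option F -` V = insert None (Some ` (topspace euclidean - C)))"
      by blast
  qed
  moreover have "topspace riemann_sphere = UNIV"
    by (auto simp: riemann_sphere_def notin_range_Some)
  ultimately show ?thesis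
    by (simp add: continuous_map_def vimage_def)
qed

lemma homeomorphic_map_riemann_sphere:
  assumes "homeomorphism UNIV UNIV F G"
  shows "homeomorphic_map riemann_sphere riemann_sphere (map_option F)"
proof -
  have "G (F x) = x" "F (G y) = y" for x y
    using assms by (auto simp: homeomorphism_def)
  then have "homeomorphic_maps riemann_sphere riemann_sphere (map_option F) (map_option G)"
    using assms continuous_map_riemann_sphere[of F G] continuous_map_riemann_sphere[of G F]
    by (simp add: homeomorphic_maps_def homeomorphism_symD option.map_comp o_def option.map_ident)
  then show ?thesis
    by (rule homeomorphic_maps_map[THEN iffD1, THEN conjunct1])
qed

definition infinity_chart :: "complex option \<Rightarrow> complex" where
  "infinity_chart p = (case p of None \<Rightarrow> 0 | Some z \<Rightarrow> 1 / z)"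

lemma infinity_chart_simps [simp]: "infinity_chart None = 0" "infinity_chart (Some z) = 1 / z"
  by (simp_all add: infinity_chart_def)

lemma sphere_charts_eq: "sphere_charts = {(range Some, the), (- {Some 0}, infinity_chart)}"
  by (simp add: sphere_charts_def infinity_chart_def[abs_def])

lemma inv_into_plane_chart: "inv_into (range Some) the z = Some z"
  by (rule inv_into_f_eq) (auto intro!: inj_onI)

lemma inv_into_infinity_chart:
  "inv_into (- {Some 0}) infinity_chart w = (if w = 0 then None else Some (1 / w))"
proof (rule inv_into_f_eq)
  show "inj_on infinity_chart (- {Some 0})"
    by (rule inj_onI) (auto simp: infinity_chart_def split: option.splits)
qed auto

lemma plane_chart_image: "A \<subseteq> range Some \<Longrightarrow> the ` A = {z. Some z \<in> A}"
  by force

lemma infinity_chart_image: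
  assumes "A \<subseteq> - {Some 0}"
  shows "infinity_chart ` A = {w. (if w = 0 then None else Some (1 / w)) \<in> A}"
proof (intro set_eqI iffI)
  fix w assume "w \<in> infinity_chart ` A"
  then obtain p where "p \<in> A" "w = infinity_chart p" by blast
  then show "w \<in> {w. (if w = 0 then None else Some (1 / w)) \<in> A}"
    using assms by (cases p) auto
next
  fix w assume "w \<in> {w. (if w = 0 then None else Some (1 / w)) \<in> A}"
  then show "w \<in> infinity_chart ` A"
    by (intro image_eqI[of _ _ "if w = 0 then None else Some (1 / w)"]) auto
qed

lemma openin_sphere_complement:
  assumes "compact S"
  shows "openin riemann_sphere (sphere_complement S)"
proof -
  have "compact (complex_of_real ` S)"
    by (intro compact_continuous_image assms continuous_intros)
  moreover have "sphere_complement S = insert None (Some ` (UNIV - complex_of_real ` S))"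
    by (auto simp: sphere_complement_def riemann_sphere_def)
  ultimately show ?thesis
    unfolding riemann_sphere_def openin_Alexandroff_compactification
    by (intro disjI2 exI[of _ "complex_of_real ` S"]) (simp add: compact_imp_closed)
qed

text \<open>Since \<open>1 / 0 = 0\<close> and \<open>0 \<in> E\<close>, the first set omits the
  origin. The second adds it, as the coordinate of infinity; boundedness of \<open>E\<close>
  supplies a ball around it.\<close>

lemma open_one_over_preimage:
  assumes "compact E" "(0 :: complex) \<in> E"
  shows "open {w. 1 / w \<notin> E}" "open (insert 0 {w. 1 / w \<notin> E})"
proof -
  have "open ((- {0}) \<inter> (\<lambda>w. 1 / w) -` (- E))"
    using assms by (intro continuous_open_preimage continuous_intros) (auto simp: compact_imp_closed)
  moreover have "(- {0}) \<inter> (\<lambda>w. 1 / w) -` (- E) = {w. 1 / w \<notin> E}"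
    using assms(2) by auto
  ultimately show 1: "open {w. 1 / w \<notin> E}" by simp
  obtain B where B: "B > 0" "\<And>z. z \<in> E \<Longrightarrow> norm z \<le> B"
    using compact_imp_bounded[OF assms(1)] unfolding bounded_pos by blast
  have "1 / w \<notin> E" if "w \<in> ball 0 (1 / B)" "w \<noteq> 0" for w
  proof
    assume "1 / w \<in> E"
    then have "1 / norm w \<le> B" using B(2) by (fastforce simp: norm_divide)
    then show False using that B(1) by (simp add: field_simps)
  qed
  then have "insert 0 {w. 1 / w \<notin> E} = {w. 1 / w \<notin> E} \<union> ball 0 (1 / B)"
    using B(1) by auto
  then show "open (insert 0 {w. 1 / w \<notin> E})" using 1 by auto
qed

section \<open>The extension as a quasiconformal homeomorphism of sphere complements\<close>

context quasisymmetric_line_map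
begin

lemma tendsto_extension_at_infinity: "((\<lambda>w. 1 / extension (1 / w)) \<longlongrightarrow> 0) (at 0)"
proof -
  have "filterlim extension at_infinity at_infinity"
    unfolding filterlim_at_infinity[OF order_refl]
  proof (intro allI impI)
    fix r :: real
    have "r \<le> norm (extension z)" if "2 * (r + 2) \<le> norm z" for z
      using norm_extension_ge[of z] that by simp
    then show "\<forall>\<^sub>F z in at_infinity. r \<le> norm (extension z)"
      unfolding eventually_at_infinity by blast
  qed
  then have "filterlim (\<lambda>w. extension (inverse w)) at_infinity (at 0)"
    by (rule filterlim_compose) (rule filterlim_inverse_at_infinity)
  then have "((\<lambda>w. inverse (extension (inverse w))) \<longlongrightarrow> 0) (at 0)"
    by (rule filterlim_compose[OF tendsto_inverse_0])
  then show ?thesis by (simp add: inverse_eq_divide)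
qed

text \<open>\<open>0 \<in> S\<close> and \<open>h 0 = 0\<close> place the only zero of the extension
  outside the domain, so \<open>1 / extension\<close> has no pole in any chart. One dilatation bound
  serves all four pairs of charts.\<close>

lemma quasiconformally_equivalent_complements:
  assumes S: "compact S" "0 \<in> S" and T: "compact T" and hT: "\<And>x. h x \<in> T \<longleftrightarrow> x \<in> S" and h0: "h 0 = 0"
  shows "quasiconformally_equivalent (sphere_complement S) (sphere_complement T)"
proof -
  obtain k where k: "0 \<le> k" "k < 1" "\<forall>z. Im z \<noteq> 0 \<longrightarrow> norm (ext_zbar z) \<le> k * norm (ext_z z)"
    using norm_ext_zbar_le by blast
  define E where "E = complex_of_real ` S"
  have E: "compact E" unfolding E_def
    by (intro compact_continuous_image S continuous_intros)
  have "0 \<in> E" using S(2) by (force simp: E_def)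
  have ext_T: "extension z \<in> complex_of_real ` T \<longleftrightarrow> z \<in> E" for z
    unfolding extension_real_iff E_def using hT by (auto simp: vimage_def)
  have ext_0: "extension z = 0 \<longleftrightarrow> z = 0" for z
    using extension_of_real[of 0] h0 inj_extension by (metis injD of_real_0)
  have ext_inj: "extension z = extension w \<longleftrightarrow> z = w" for z w
    using inj_extension by (auto dest: injD)
  define f where "f = map_option extension"
  define X Y where "X = sphere_complement S" and "Y = sphere_complement T"
  have topspace: "topspace riemann_sphere = UNIV"
    by (auto simp: riemann_sphere_def notin_range_Some)
  have X: "None \<in> X" "Some z \<in> X \<longleftrightarrow> z \<notin> E" for z
    by (auto simp: X_def sphere_complement_def topspace E_def)
  have Y: "None \<in> Y" "Some z \<in> Y \<longleftrightarrow> z \<notin> complex_of_real ` T" for z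
    by (auto simp: Y_def sphere_complement_def topspace)
  have fXY: "f p \<in> Y \<longleftrightarrow> p \<in> X" for p
    by (cases p) (simp_all add: X Y f_def ext_T)
  have "homeomorphic_map (subtopology riemann_sphere X) (subtopology riemann_sphere Y) f"
  proof (rule homeomorphic_map_subtopologies)
    obtain G where "homeomorphism UNIV UNIV extension G"
      using invariance_of_domain_homeomorphism[OF open_UNIV continuous_extension _ inj_extension]
        surj_extension by auto
    then show hom: "homeomorphic_map riemann_sphere riemann_sphere f"
      unfolding f_def by (rule homeomorphic_map_riemann_sphere)
    have "surj f"
      using homeomorphic_imp_surjective_map[OF hom] topspace by simp
    then show "f ` (topspace riemann_sphere \<inter> X) = topspace riemann_sphere \<inter> Y"
      using fXY unfolding topspace by (auto simp: surj_def image_iff) metis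
  qed
  moreover have "quasiconformal_on ((1 + k) / (1 - k)) (\<phi> ` {p \<in> X. p \<in> D \<and> f p \<in> D'}) (\<psi> \<circ> f \<circ> inv_into D \<phi>)"
    if charts: "(D, \<phi>) \<in> sphere_charts" "(D', \<psi>) \<in> sphere_charts" for D \<phi> D' \<psi>
  proof -
    define V where "V = {w. 1 / w \<notin> E}"
    have V: "open V" "open (insert 0 V)"
      using open_one_over_preimage[OF E \<open>0 \<in> E\<close>] by (simp_all add: V_def)
    have V0: "w \<noteq> 0" if "w \<in> V" for w
      using that \<open>0 \<in> E\<close> by (auto simp: V_def)
    have "open (- E)" using E by (simp add: compact_imp_closed open_Compl)
    note cont = continuous_on_compose2[OF continuous_extension _ subset_UNIV]
    note chart = quasiconformal_on_chart[OF k]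
    have id: "(\<lambda>w. w) \<in> coordinate_changes" and inv: "(\<lambda>w. 1 / w) \<in> coordinate_changes"
      by (auto simp: coordinate_changes_def)
    consider "D = range Some" "\<phi> = the" "D' = range Some" "\<psi> = the"
      | "D = range Some" "\<phi> = the" "D' = - {Some 0}" "\<psi> = infinity_chart"
      | "D = - {Some 0}" "\<phi> = infinity_chart" "D' = range Some" "\<psi> = the"
      | "D = - {Some 0}" "\<phi> = infinity_chart" "D' = - {Some 0}" "\<psi> = infinity_chart"
      using charts unfolding sphere_charts_eq by auto
    then show ?thesis
    proof cases
      case 1
      have "\<psi> \<circ> f \<circ> inv_into D \<phi> = extension"
        by (simp add: 1 fun_eq_iff inv_into_plane_chart f_def)
      moreover have "\<phi> ` {p \<in> X. p \<in> D \<and> f p \<in> D'} = - E"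
        unfolding 1 by (subst plane_chart_image) (auto simp: X f_def)
      moreover have "quasiconformal_on ((1 + k) / (1 - k)) (- E) extension"
        by (rule chart[OF \<open>open (- E)\<close> _ _ id id])
           (auto intro: continuous_on_subset[OF continuous_extension] inj_onI simp: ext_inj)
      ultimately show ?thesis by simp
    next
      case 2
      have "\<psi> \<circ> f \<circ> inv_into D \<phi> = (\<lambda>z. 1 / extension z)"
        by (simp add: 2 fun_eq_iff inv_into_plane_chart f_def)
      moreover have "\<phi> ` {p \<in> X. p \<in> D \<and> f p \<in> D'} = - E"
        unfolding 2 using \<open>0 \<in> E\<close> by (subst plane_chart_image) (auto simp: X f_def ext_0)
      moreover have "quasiconformal_on ((1 + k) / (1 - k)) (- E) (\<lambda>z. 1 / extension z)"
        by (rule chart[OF \<open>open (- E)\<close> _ _ id inv])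
           (use \<open>0 \<in> E\<close> in \<open>auto intro!: continuous_intros cont inj_onI simp: ext_inj ext_0\<close>)
      ultimately show ?thesis by simp
    next
      case 3
      \<comment> \<open>\<open>the None\<close> is the unspecified value at the coordinate of
        infinity. It never matters, since \<open>f\<close> fixes infinity, which the target chart
        omits, so \<open>V\<close> does not contain 0.\<close>
      have "\<psi> \<circ> f \<circ> inv_into D \<phi> = (\<lambda>w. if w = 0 then the None else extension (1 / w))"
        by (simp add: 3 fun_eq_iff inv_into_infinity_chart f_def)
      moreover have "\<phi> ` {p \<in> X. p \<in> D \<and> f p \<in> D'} = V"
        unfolding 3 using V0 \<open>0 \<in> E\<close> by (subst infinity_chart_image) (auto simp: X f_def V_def)
      moreover have "quasiconformal_on ((1 + k) / (1 - k)) V (\<lambda>w. if w = 0 then the None else extension (1 / w))"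
      proof (rule chart[OF V(1) _ _ inv id])
        have "continuous_on V (\<lambda>w. extension (1 / w))"
          using V0 by (intro cont continuous_intros) auto
        then show "continuous_on V (\<lambda>w. if w = 0 then the None else extension (1 / w))"
          by (rule continuous_on_eq) (use V0 in auto)
      qed (use V0 in \<open>auto intro!: inj_onI simp: ext_inj\<close>)
      ultimately show ?thesis by simp
    next
      case 4
      \<comment> \<open>One formula suffices also at \<open>w = 0\<close>: with
        \<open>1 / 0 = 0\<close> and \<open>extension 0 = 0\<close> its value is 0, the coordinate
        of infinity.\<close>
      have "\<psi> \<circ> f \<circ> inv_into D \<phi> = (\<lambda>w. 1 / extension (1 / w))"
        using ext_0 by (auto simp: 4 fun_eq_iff inv_into_infinity_chart f_def)
      moreover have "\<phi> ` {p \<in> X. p \<in> D \<and> f p \<in> D'} = insert 0 V"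
        unfolding 4 using V0 \<open>0 \<in> E\<close> by (subst infinity_chart_image) (auto simp: X f_def V_def ext_0)
      moreover have "quasiconformal_on ((1 + k) / (1 - k)) (insert 0 V) (\<lambda>w. 1 / extension (1 / w))"
      proof (rule chart[OF V(2) _ _ inv inv])
        have "isCont (\<lambda>w. 1 / extension (1 / w)) w" for w
        proof (cases "w = 0")
          case True
          then show ?thesis
            using tendsto_extension_at_infinity ext_0[of 0] by (simp add: isCont_def)
        next
          case False
          have "continuous_on (- {0}) (\<lambda>w. 1 / extension (1 / w))"
            using ext_0 by (intro continuous_intros cont) auto
          then show ?thesis
            using False continuous_on_eq_continuous_at[OF open_Compl[OF closed_singleton[of 0]]] by blast
        qed
        then show "continuous_on (insert 0 V) (\<lambda>w. 1 / extension (1 / w))"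
          by (simp add: continuous_at_imp_continuous_on)
      qed (auto intro!: inj_onI simp: ext_inj ext_0)
      ultimately show ?thesis by simp
    qed
  qed
  ultimately have "quasiconformal_homeomorphism ((1 + k) / (1 - k)) X Y f"
    unfolding quasiconformal_homeomorphism_def X_def Y_def
    using openin_sphere_complement S(1) T by blast
  then show ?thesis
    unfolding quasiconformally_equivalent_def X_def Y_def by blast
qed

end

theorem corollary1p2:
  fixes q :: "nat \<Rightarrow> real"
  assumes "\<And>n. n \<ge> 1 \<Longrightarrow> 0 < q n \<and> q n < 1"
    and "\<exists>\<delta>>0. \<forall>n\<ge>1. \<delta> \<le> q n \<and> q n \<le> 1 - \<delta>"
  shows "quasiconformally_equivalent
    (sphere_complement (random_cantor_set q))
    (sphere_complement middle_third_cantor_set)"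
proof -
  obtain \<delta> where "\<delta> > 0" "\<And>n. n \<ge> 1 \<Longrightarrow> \<delta> \<le> q n \<and> q n \<le> 1 - \<delta>"
    using assms(2) by blast
  then interpret cantor_ratios q \<delta>
    by unfold_locales auto
  obtain M where "M \<ge> 1" "\<And>x t. t > 0 \<Longrightarrow> h (x + t) - h x \<le> M * (h x - h (x - t))"
    "\<And>x t. t > 0 \<Longrightarrow> h x - h (x - t) \<le> M * (h (x + t) - h x)"
    using h_quasisymmetric by blast
  then interpret E: quasisymmetric_line_map h M
    using h_continuous h_strict_mono h_close by unfold_locales auto
  show ?thesis
  proof (rule E.quasiconformally_equivalent_complements)
    show "compact middle_third_cantor_set"
      unfolding middle_third_cantor_set_def by (rule compact_random_cantor_set)
    show "h 0 = 0" using h_grid[of 0 0] by simp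
  qed (use assms(1) in \<open>auto simp: h_cantor_iff compact_random_cantor_set intro: zero_in_random_cantor_set\<close>)
qed

end
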